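(* Let $m\in\mathbb{N}$ (so $m\geq 1$), let $I:(0,\infty)\to(0,\infty)$ be a non-decreasing left-continuous function and let $\|\cdot\|_X$ and $\|\cdot\|_Y$ be rearrangement invariant Banach function norms over $((0,\infty),\lambda)$, where $\lambda$ is the Lebesgue measure. Let $X$ be the corresponding Banach function space of $\|\cdot\|_X$. Suppose that $\Phi_I^m(t,s)$ is essentially decreasing in $t$ (see context). Then the following statements are equivalent: (i) There exists a constant $C\in\mathbb{R}$ such that $$\left\| \int_t^{\infty} \frac{f(s)}{I(s)} \left( \int_t^s \frac{1}{I(r)}\,dr\right)^{m-1} ds \right\|_Y \le C\,\|f\|_X$$ for all non-negative $f\in X$. (ii) There exists a constant $C'\in\mathbb{R}$ such that $$\left\| \int_t^{\infty} \frac{f(s)}{I(s)} \left( \int_t^s \frac{1}{I(r)}\,dr\right)^{m-1} ds \right\|_Y \le C'\,\|f\|_X$$ for all non-increasing non-negative $f\in X$. Furthermore, if (ii) holds with a constant $C'$, then (i) holds with $C=2^{m+1}C'$. (In both inequalities the norm $\|\cdot\|_Y$ is applied to the displayed integral as a function of $t\in(0,\infty)$.)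
   Context: Let $\lambda$ be Lebesgue measure on $(0,\infty)$, let $M$ be the set of all (extended complex-valued) $\lambda$-measurable functions on $(0,\infty)$, and let $M_+$ be the set of non-negative measurable functions on $(0,\infty)$, with values in $[0,\infty]$; functions equal $\lambda$-a.e. are identified. For $f\in M_+$ the distribution function is $\lambda_f(s)=\lambda(\{t\in(0,\infty): f(t)>s\})$, $s\in[0,\infty)$. Two functions $f,g\in M_+$ are equimeasurable if $\lambda_f=\lambda_g$. A functional $\|\cdot\|:M_+\to[0,\infty]$ is a Banach function norm if: (P1) it is positively homogeneous, subadditive, and $\|f\|=0$ if and only if $f=0$ a.e.; (P2) $f\le g$ a.e. implies $\|f\|\le\|g\|$; (P3) if $f_n,f\in M_+$ and $f_n\uparrow f$ a.e., then $\|f_n\|\uparrow\|f\|$; (P4) $\|\chi_E\|<\infty$ for every measurable $E\subseteq(0,\infty)$ with $\lambda(E)<\infty$; (P5) for every measurable $E\subseteq(0,\infty)$ with $\lambda(E)<\infty$ there is a finite constant $C_E$, depending only on $E$, such that $\int_E f\,d\lambda\le C_E\|f\|$ for all $f\in M_+$. It is rearrangement invariant if moreover (P6) $\|f\|=\|g\|$ whenever $f,g\in M_+$ are equimeasurable. A Banach function norm is extended to $M$ by $\|f\|:=\|\,|f|\,\|$, and the corresponding Banach function space is $X=\{f\in M:\|f\|_X<\infty\}$. For $s,t\in(0,\infty)$ put $$\Phi_I^m(t,s)=\frac{1}{I(t)}\left(\int_s^t\frac{1}{I(\tau)}\,d\tau\right)^{m-1},$$ where for $m=1$ the power is understood as $1$,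 so that $\Phi_I^1(t,s)=1/I(t)$, and $\int_s^t$ is the oriented integral. For a left-continuous non-decreasing $I$, the function $\Phi_I^m(t,s)$ is said to be essentially decreasing in $t$ if $$\forall s_0\in(0,\infty)\ \exists t_0\in(0,\infty)\ \forall t\in(t_0,\infty)\ \exists r_t\in(0,\infty)\ \forall r\in(r_t,\infty)\ \forall s\in(0,s_0):\ \Phi_I^m(t,s)\ge\Phi_I^m(r,s).$$ *)

theory Defs
  imports "HOL-Analysis.Analysis"
begin

abbreviation halfline :: "real measure" where
  "halfline \<equiv> lebesgue_on {0<..}"

text \<open>A function on the half-line is represented by a function on all of \<^typ>\<open>real\<close>, whose
  values outside \<^term>\<open>{0<..} :: real set\<close> are irrelevant. Almost everywhere equal functions are
  not identified; axiom \<open>P2\<close> below forces norms to agree on them.\<close>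

definition M_plus :: "(real \<Rightarrow> ennreal) set" where
  "M_plus = borel_measurable halfline"

definition distribution_function :: "(real \<Rightarrow> ennreal) \<Rightarrow> real \<Rightarrow> ennreal" where
  "distribution_function f s = emeasure halfline {t \<in> {0<..}. f t > ennreal s}"

definition equimeasurable :: "(real \<Rightarrow> ennreal) \<Rightarrow> (real \<Rightarrow> ennreal) \<Rightarrow> bool" where
  "equimeasurable f g \<longleftrightarrow>
     (\<forall>s\<in>{0..}. distribution_function f s = distribution_function g s)"

locale banach_function_norm =
  fixes N :: "(real \<Rightarrow> ennreal) \<Rightarrow> ennreal"
  assumes P1_homogeneous:
      "\<And>f a. f \<in> M_plus \<Longrightarrow> 0 \<le> (a::real) \<Longrightarrow> N (\<lambda>t. ennreal a * f t) = ennreal a * N f"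
    and P1_subadditive:
      "\<And>f g. f \<in> M_plus \<Longrightarrow> g \<in> M_plus \<Longrightarrow> N (\<lambda>t. f t + g t) \<le> N f + N g"
    and P1_zero:
      "\<And>f. f \<in> M_plus \<Longrightarrow> N f = 0 \<longleftrightarrow> (AE t in halfline. f t = 0)"
    and P2:
      "\<And>f g. f \<in> M_plus \<Longrightarrow> g \<in> M_plus \<Longrightarrow> (AE t in halfline. f t \<le> g t) \<Longrightarrow> N f \<le> N g"
    and P3:
      "\<And>F f. (\<And>n::nat. F n \<in> M_plus) \<Longrightarrow> f \<in> M_plus \<Longrightarrow>
         (AE t in halfline. incseq (\<lambda>n. F n t) \<and> (\<lambda>n. F n t) \<longlonglongrightarrow> f t) \<Longrightarrow>
         incseq (\<lambda>n. N (F n)) \<and> (\<lambda>n. N (F n)) \<longlonglongrightarrow> N f"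
    and P4:
      "\<And>E. E \<in> sets halfline \<Longrightarrow> emeasure halfline E < \<infinity> \<Longrightarrow> N (indicator E) < \<infinity>"
    and P5:
      "\<And>E. E \<in> sets halfline \<Longrightarrow> emeasure halfline E < \<infinity> \<Longrightarrow>
         \<exists>C::real. 0 \<le> C \<and> (\<forall>f\<in>M_plus. (\<integral>\<^sup>+t\<in>E. f t \<partial>halfline) \<le> ennreal C * N f)"

locale ri_banach_function_norm = banach_function_norm +
  assumes P6:
    "\<And>f g. f \<in> M_plus \<Longrightarrow> g \<in> M_plus \<Longrightarrow> equimeasurable f g \<Longrightarrow> N f = N g"

text \<open>The non-negative elements of the Banach function space of \<open>N\<close>; the modulus
  in the extension of the norm to general measurable functions plays no role for them.\<close>

definition bfs_nonneg :: "((real \<Rightarrow> ennreal) \<Rightarrow> ennreal) \<Rightarrow> (real \<Rightarrow> ennreal) set" where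
  "bfs_nonneg N = {f \<in> M_plus. N f < \<infinity>}"

text \<open>The interval integral is oriented: swapping its bounds changes its sign.\<close>

definition Phi :: "(real \<Rightarrow> real) \<Rightarrow> nat \<Rightarrow> real \<Rightarrow> real \<Rightarrow> real" where
  "Phi I m t s = 1 / I t * (LBINT \<tau>=s..t. 1 / I \<tau>) ^ (m - 1)"

definition essentially_decreasing :: "(real \<Rightarrow> real) \<Rightarrow> nat \<Rightarrow> bool" where
  "essentially_decreasing I m \<longleftrightarrow>
     (\<forall>s0\<in>{0<..}. \<exists>t0\<in>{0<..}. \<forall>t\<in>{t0<..}. \<exists>rt\<in>{0<..}. \<forall>r\<in>{rt<..}. \<forall>s\<in>{0<..<s0}.
        Phi I m t s \<ge> Phi I m r s)"

definition H_op :: "(real \<Rightarrow> real) \<Rightarrow> nat \<Rightarrow> (real \<Rightarrow> ennreal) \<Rightarrow> real \<Rightarrow> ennreal" where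
  "H_op I m f t =
     (\<integral>\<^sup>+s\<in>{t<..}. (f s / ennreal (I s) * ennreal ((LBINT r=t..s. 1 / I r) ^ (m - 1))) \<partial>halfline)"

end

theory Submission
  imports Defs
begin

text \<open>
  Let \<open>F y = \<integral>\<^sub>0\<^sup>y f\<close>. Replacing \<open>f\<close> by its level function, the derivative of the least concave
  majorant of \<open>F\<close>, does not increase a rearrangement invariant norm. By Tonelli,
  \<open>\<integral>\<^sub>0\<^sup>a H f = \<integral> f w\<close>, where \<open>w\<close> is the adjoint of \<open>H\<close> applied to the indicator of \<open>(0, a]\<close>. Since
  \<open>1 / I\<close> is non-increasing, \<open>w r \<le> 2\<^sup>m w s\<close> whenever \<open>r / 2 \<le> s \<le> r\<close>, and a layer cake argument on
  every interval on which the level function is constant bounds \<open>\<integral> f w\<close> by \<open>2\<^sup>m\<^sup>+\<^sup>1\<close> times the same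
  integral with the level function in place of \<open>f\<close>. The level function does not depend on \<open>a\<close>, so
  the Hardy--Littlewood--Polya principle in the target space finishes the proof without any duality.

  To avoid the structure theory of concave majorants, the level function is approximated, up to a
  factor \<open>\<rho>\<close> close to 1, by a step function whose jumps sit at maximisers of \<open>F y - \<mu> y\<close> for slopes
  \<open>\<mu>\<close> in a geometric progression of ratio \<open>\<rho>\<close>.
\<close>

subsection \<open>Integration on the half-line\<close>

text \<open>The obstacle is that neither \<open>f\<close> nor the weight \<open>w\<close> need be
  monotone: \<open>1 / I\<close> falls while the inner integral of the kernel grows, so Hardy's
  lemma does not apply to \<open>\<integral> f w\<close>. Doubling takes its place: left of a point
  where \<open>w\<close> is large there is an interval of comparable length on which
  \<open>w\<close> stays comparable. This suffices because the level function controls the averages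
  of \<open>f\<close> taken from the left end of each interval on which it is constant. The constant
  is the product of \<open>2\<close> for the halved length, \<open>2 ^ (m - 1)\<close> for the power
  of the inner integral and \<open>2\<close> for the substitution \<open>t \<mapsto> 2 t\<close> in
  the outer one.

  The axioms give no formula for a norm, so majorization must come from convexity and invariance. On
  a uniform grid, exchanging two cells preserves the norm, hence moving mass from a larger value to
  a smaller one does not increase it. Finitely many such moves and a pointwise comparison settle
  step functions; limits extend this to non-increasing functions, and excess integrals
  \<open>\<integral> (f - c)\<^sup>+\<close>, which see only the distribution of \<open>f\<close>,
  extend it to arbitrary ones.\<close>

lemma sigma_finite_halfline: "sigma_finite_measure halfline"
proof (rule sigma_finite_measure_restrict_space)
  show "sigma_finite_measure (lebesgue :: real measure)"
  proof
    show "\<exists>A. countable A \<and> A \<subseteq> sets (lebesgue :: real measure) \<and> \<Union> A = space lebesgue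
        \<and> (\<forall>a\<in>A. emeasure lebesgue a \<noteq> \<infinity>)"
    proof (intro exI[of _ "range (\<lambda>n::nat. {- real n .. real n})"] conjI)
      show "\<Union> (range (\<lambda>n::nat. {- real n .. real n})) = space lebesgue"
      proof -
        have "\<exists>n::nat. - real n \<le> x \<and> x \<le> real n" for x :: real
          by (metis abs_le_iff minus_le_iff real_arch_simple)
        then show ?thesis by auto
      qed
    qed auto
  qed
qed auto

lemma borel_imp_measurable_halfline:
  "h \<in> measurable borel N \<Longrightarrow> h \<in> measurable halfline N"
  by (intro measurable_restrict_space1) (auto intro: measurable_completion)

lemma sets_halfline_borel: "A \<in> sets borel \<Longrightarrow> A \<subseteq> {0<..} \<Longrightarrow> A \<in> sets halfline"
  by (simp add: sets_restrict_space_iff)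

lemma emeasure_halfline_Ioc:
  "0 \<le> a \<Longrightarrow> a \<le> b \<Longrightarrow> emeasure halfline {a<..b} = ennreal (b - a)"
  by (subst emeasure_restrict_space) auto

text \<open>Each value \<open>g x\<close> is the length of the set of levels below it, and Tonelli
  exchanges the two integrals. The measure is arbitrary because the formula is also applied to
  densities with respect to \<open>halfline\<close>.\<close>

lemma nn_integral_layer_cake:
  assumes "sigma_finite_measure M" and [measurable]: "g \<in> borel_measurable M"
  shows "(\<integral>\<^sup>+x. g x \<partial>M)
    = (\<integral>\<^sup>+l. indicator {0..} l * emeasure M {x \<in> space M. ennreal l < g x} \<partial>lborel)"
proof -
  interpret sigma_finite_measure M by fact
  interpret pair_sigma_finite M lborel ..
  have "(\<integral>\<^sup>+l. indicator {0..} l * indicator {l. ennreal l < u} l \<partial>lborel) = u"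
    for u :: ennreal
  proof (cases u)
    case (real r)
    have "(\<integral>\<^sup>+l. indicator {0..} l * indicator {l. ennreal l < u} l \<partial>lborel)
        = (\<integral>\<^sup>+l. indicator {0..<r} l \<partial>lborel)"
      using real by (intro nn_integral_cong) (auto simp: indicator_def ennreal_less_iff)
    then show ?thesis using real by simp
  next
    case top
    have "(\<integral>\<^sup>+l. indicator {0..} l * indicator {l. ennreal l < u} l \<partial>lborel)
        = (\<integral>\<^sup>+l. indicator {0::real..} l \<partial>lborel)"
      using top by (intro nn_integral_cong) (auto simp: indicator_def)
    moreover have "emeasure lborel {0::real..} = \<infinity>"
    proof -
      have "ennreal (real n) \<le> emeasure lborel {0::real..}" for n :: nat
        using emeasure_mono[of "{0..real n}" "{0..}" lborel] by simp
      then show ?thesis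
        by (metis ennreal_less_iff ennreal_leI ennreal_cases infinity_ennreal_def not_le of_nat_0_le_iff
            reals_Archimedean2 ennreal_le_iff)
    qed
    ultimately show ?thesis using top by simp
  qed
  then have "(\<integral>\<^sup>+x. g x \<partial>M)
      = (\<integral>\<^sup>+x. \<integral>\<^sup>+l. indicator {0..} l * indicator {l. ennreal l < g x} l \<partial>lborel \<partial>M)"
    by simp
  also have "\<dots> = (\<integral>\<^sup>+l. \<integral>\<^sup>+x. indicator {0..} l * indicator {l. ennreal l < g x} l \<partial>M \<partial>lborel)"
    by (rule Fubini'[symmetric]) (simp add: indicator_def)
  also have "\<dots> = (\<integral>\<^sup>+l. indicator {0..} l * emeasure M {x \<in> space M. ennreal l < g x} \<partial>lborel)"
  proof (rule nn_integral_cong)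
    fix l :: real
    have "(\<integral>\<^sup>+x. indicator {l. ennreal l < g x} l \<partial>M)
        = (\<integral>\<^sup>+x. indicator {x \<in> space M. ennreal l < g x} x \<partial>M)"
      by (intro nn_integral_cong) (auto simp: indicator_def)
    then show "(\<integral>\<^sup>+x. indicator {0..} l * indicator {l. ennreal l < g x} l \<partial>M)
        = indicator {0..} l * emeasure M {x \<in> space M. ennreal l < g x}"
      by (simp add: nn_integral_cmult)
  qed
  finally show ?thesis .
qed

subsection \<open>Norms of step functions and majorization\<close>

text \<open>This is the Fatou property. \<open>P3\<close> covers increasing sequences, so
  \<open>F\<close> is replaced by its tail infima \<open>G\<close>, which lie below \<open>F\<close>
  and increase to the same limit.\<close>

lemma (in banach_function_norm) norm_le_of_tendsto:
  assumes F: "\<And>n::nat. F n \<in> M_plus" and f: "f \<in> M_plus"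
    and lim: "AE t in halfline. (\<lambda>n. F n t) \<longlonglongrightarrow> f t"
    and bound: "\<And>n. N (F n) \<le> c"
  shows "N f \<le> c"
proof -
  have [measurable]: "F n \<in> borel_measurable halfline" for n
    using F by (simp add: M_plus_def)
  define G where "G n t = (INF k\<in>{n..}. F k t)" for n t
  have G: "G n \<in> M_plus" for n
    unfolding M_plus_def G_def by measurable
  have "AE t in halfline. incseq (\<lambda>n. G n t) \<and> (\<lambda>n. G n t) \<longlonglongrightarrow> f t"
    using lim
  proof eventually_elim
    case (elim t)
    have inc: "incseq (\<lambda>n. G n t)"
      unfolding G_def incseq_def by (auto intro!: INF_superset_mono)
    then have "(\<lambda>n. G n t) \<longlonglongrightarrow> (SUP n. G n t)"
      by (rule LIMSEQ_SUP)
    moreover have "(SUP n. G n t) = f t"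
      using lim_imp_Liminf[OF _ elim] by (simp add: G_def liminf_SUP_INF)
    ultimately show ?case using inc by simp
  qed
  from P3[OF G f this] have "(\<lambda>n. N (G n)) \<longlonglongrightarrow> N f" by simp
  moreover have "N (G n) \<le> c" for n
  proof -
    have "N (G n) \<le> N (F n)"
      by (intro P2 G F AE_I2) (auto simp: G_def intro: INF_lower)
    with bound[of n] show ?thesis by simp
  qed
  ultimately show ?thesis by (intro LIMSEQ_le_const2) auto
qed

lemma (in banach_function_norm) norm_finite_imp_integral_finite:
  assumes "f \<in> M_plus" "N f < \<infinity>" "0 \<le> a"
  shows "(\<integral>\<^sup>+t\<in>{0<..a}. f t \<partial>halfline) < \<infinity>"
proof -
  have "{0<..a} \<in> sets halfline" by (auto intro: sets_halfline_borel)
  moreover have "emeasure halfline {0<..a} < \<infinity>"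
    using emeasure_halfline_Ioc[of 0 a] assms by simp
  ultimately obtain C where "\<forall>f\<in>M_plus. (\<integral>\<^sup>+t\<in>{0<..a}. f t \<partial>halfline) \<le> ennreal C * N f"
    using P5 by blast
  with assms(1) have "(\<integral>\<^sup>+t\<in>{0<..a}. f t \<partial>halfline) \<le> ennreal C * N f" by blast
  also have "\<dots> < \<infinity>" using assms(2) by (simp add: ennreal_mult_less_top)
  finally show ?thesis .
qed

text \<open>Cells are closed on the right: they tile the open half-line and contain the point where
  a non-increasing function attains its minimum on them.\<close>

definition cell :: "real \<Rightarrow> nat \<Rightarrow> real set" where
  "cell d i = {d * real i <.. d * (real i + 1)}"

text \<open>The values are real because transfers between cells subtract; \<open>ennreal\<close>
  sends negative values to 0.\<close>

definition step_fun :: "real \<Rightarrow> nat \<Rightarrow> (nat \<Rightarrow> real) \<Rightarrow> real \<Rightarrow> ennreal" where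
  "step_fun d n v x = (\<Sum>i<n. ennreal (v i) * indicator (cell d i) x)"

lemma cell_unique:
  assumes "0 < d" "x \<in> cell d i" "x \<in> cell d j"
  shows "i = j"
proof -
  have "\<not> i < j" if "x \<in> cell d i" "x \<in> cell d j" for i j
  proof
    assume "i < j"
    then have "d * (real i + 1) \<le> d * real j" using assms(1) by (intro mult_left_mono) auto
    with that show False by (auto simp: cell_def)
  qed
  with assms show ?thesis by (metis nat_neq_iff)
qed

lemma cell_subset: "0 < d \<Longrightarrow> cell d i \<subseteq> {0<..}"
  unfolding cell_def by (auto intro: le_less_trans[of 0 "d * real i"])

lemma sets_cell: "0 < d \<Longrightarrow> cell d i \<in> sets halfline"
  by (intro sets_halfline_borel cell_subset) (auto simp: cell_def)

lemma emeasure_cell: "0 < d \<Longrightarrow> emeasure halfline (cell d i) = ennreal d"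
  unfolding cell_def by (subst emeasure_halfline_Ioc) (auto simp: algebra_simps)

lemma step_fun_cell:
  assumes "0 < d" "i < n" "x \<in> cell d i"
  shows "step_fun d n v x = ennreal (v i)"
proof -
  have "x \<in> cell d j \<longleftrightarrow> j = i" for j
    using cell_unique[OF assms(1), of x i j] assms(3) by auto
  then have "step_fun d n v x = (\<Sum>j<n. if j = i then ennreal (v i) else 0)"
    unfolding step_fun_def by (intro sum.cong) (simp_all add: indicator_def)
  then show ?thesis using assms by simp
qed

lemma step_fun_outside: "(\<And>i. i < n \<Longrightarrow> x \<notin> cell d i) \<Longrightarrow> step_fun d n v x = 0"
  unfolding step_fun_def by (intro sum.neutral) auto

lemma step_fun_M_plus: "0 < d \<Longrightarrow> step_fun d n v \<in> M_plus"
  unfolding M_plus_def step_fun_def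
  by (intro borel_measurable_sum borel_measurable_times_ennreal borel_measurable_indicator sets_cell) auto

lemma step_fun_le:
  assumes "0 < d" and "\<And>i x. i < n \<Longrightarrow> x \<in> cell d i \<Longrightarrow> ennreal (v i) \<le> g x"
  shows "step_fun d n v x \<le> g x"
proof (cases "\<exists>i<n. x \<in> cell d i")
  case True
  then obtain i where "i < n" "x \<in> cell d i" by blast
  with assms show ?thesis by (simp add: step_fun_cell)
next
  case False
  then show ?thesis using step_fun_outside[of n x d v] by auto
qed

lemma step_fun_mono:
  assumes "\<And>i. i < n \<Longrightarrow> v i \<le> w i"
  shows "step_fun d n v x \<le> step_fun d n w x"
  unfolding step_fun_def using assms by (intro sum_mono mult_right_mono ennreal_leI) auto

text \<open>All cells have the same measure, so the distribution merely counts the values above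
  \<open>s\<close> and does not see their order.\<close>

lemma distribution_step_fun:
  assumes d: "0 < d" and "0 \<le> s"
  shows "distribution_function (step_fun d n v) s = (\<Sum>i<n. if s < v i then ennreal d else 0)"
proof -
  have "{t \<in> {0<..}. step_fun d n v t > ennreal s} = (\<Union>i\<in>{i. i < n \<and> s < v i}. cell d i)"
  proof (intro set_eqI iffI)
    fix t assume t: "t \<in> {t \<in> {0<..}. step_fun d n v t > ennreal s}"
    then obtain i where i: "i < n" "t \<in> cell d i"
      using step_fun_outside[of n t d v] by fastforce
    with t have "ennreal s < ennreal (v i)" using step_fun_cell[OF d i] by simp
    with i assms(2) show "t \<in> (\<Union>i\<in>{i. i < n \<and> s < v i}. cell d i)"
      by (auto simp: ennreal_less_iff)
  next
    fix t assume "t \<in> (\<Union>i\<in>{i. i < n \<and> s < v i}. cell d i)"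
    then obtain i where i: "i < n" "s < v i" "t \<in> cell d i" by blast
    then show "t \<in> {t \<in> {0<..}. step_fun d n v t > ennreal s}"
      using step_fun_cell[OF d, of i n t v] cell_subset[OF d] assms(2)
      by (auto simp: ennreal_less_iff)
  qed
  then have "distribution_function (step_fun d n v) s
      = emeasure halfline (\<Union>i\<in>{i. i < n \<and> s < v i}. cell d i)"
    by (simp add: distribution_function_def)
  also have "\<dots> = (\<Sum>i\<in>{i. i < n \<and> s < v i}. emeasure halfline (cell d i))"
    using sets_cell[OF d] cell_unique[OF d]
    by (intro sum_emeasure[symmetric]) (auto simp: disjoint_family_on_def)
  also have "\<dots> = (\<Sum>i\<in>{i. i < n \<and> s < v i}. ennreal d)"
    by (simp add: emeasure_cell[OF d])
  also have "\<dots> = (\<Sum>i<n. if s < v i then ennreal d else 0)"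
    by (subst sum.If_cases) (auto intro!: sum.cong simp: lessThan_def Int_def)
  finally show ?thesis .
qed

context ri_banach_function_norm
begin

lemma norm_step_fun_swap:
  assumes "0 < d" "j < n" "k < n"
  shows "N (step_fun d n (v(j := v k, k := v j))) = N (step_fun d n v)"
proof (intro P6 step_fun_M_plus assms)
  have "distribution_function (step_fun d n (v(j := v k, k := v j))) s
      = distribution_function (step_fun d n v) s" if "0 \<le> s" for s
    unfolding distribution_step_fun[OF assms(1) that]
    by (rule sum.reindex_bij_witness[of _ "id(j := k, k := j)" "id(j := k, k := j)"])
       (use assms in \<open>auto simp: fun_upd_def\<close>)
  then show "equimeasurable (step_fun d n (v(j := v k, k := v j))) (step_fun d n v)"
    by (simp add: equimeasurable_def)
qed

text \<open>The new vector is a convex combination of \<open>v\<close> and of \<open>v\<close> with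
  the entries \<open>j\<close> and \<open>k\<close> exchanged. Both have the same norm, and the norm
  is convex.\<close>

lemma norm_step_fun_transfer:
  assumes d: "0 < d" and jk: "j < n" "k < n" and v: "\<And>i. i < n \<Longrightarrow> 0 \<le> v i"
    and e: "0 < e" "e \<le> v j - v k"
  shows "N (step_fun d n (v(j := v j - e, k := v k + e))) \<le> N (step_fun d n v)"
proof -
  define \<theta> where "\<theta> = e / (v j - v k)"
  have \<theta>: "0 \<le> \<theta>" "\<theta> \<le> 1" "\<theta> * (v j - v k) = e" using e by (auto simp: \<theta>_def)
  have "step_fun d n (v(j := v j - e, k := v k + e)) x
      = ennreal (1 - \<theta>) * step_fun d n v x + ennreal \<theta> * step_fun d n (v(j := v k, k := v j)) x" for x
  proof -
    have "ennreal ((v(j := v j - e, k := v k + e)) i)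
        = ennreal (1 - \<theta>) * ennreal (v i) + ennreal \<theta> * ennreal ((v(j := v k, k := v j)) i)"
      if "i < n" for i
    proof -
      have "(v(j := v j - e, k := v k + e)) i = (1 - \<theta>) * v i + \<theta> * (v(j := v k, k := v j)) i"
      proof -
        have "e = \<theta> * v j - \<theta> * v k" using \<theta>(3) by (simp add: right_diff_distrib)
        moreover have "(1 - \<theta>) * x + \<theta> * y = x - \<theta> * x + \<theta> * y" for x y
          by (simp add: left_diff_distrib)
        ultimately show ?thesis using e by (simp add: fun_upd_def)
      qed
      moreover have "0 \<le> v i" "0 \<le> (v(j := v k, k := v j)) i"
        using v that jk by (auto simp: fun_upd_def)
      ultimately show ?thesis using \<theta> by (simp add: ennreal_plus ennreal_mult)
    qed
    then show ?thesis
      unfolding step_fun_def sum_distrib_left sum.distrib[symmetric]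
      by (intro sum.cong) (auto simp: distrib_right mult.assoc)
  qed
  then have "N (step_fun d n (v(j := v j - e, k := v k + e)))
     = N (\<lambda>x. ennreal (1 - \<theta>) * step_fun d n v x + ennreal \<theta> * step_fun d n (v(j := v k, k := v j)) x)"
    by presburger
  also have "\<dots> \<le> N (\<lambda>x. ennreal (1 - \<theta>) * step_fun d n v x)
      + N (\<lambda>x. ennreal \<theta> * step_fun d n (v(j := v k, k := v j)) x)"
    by (rule P1_subadditive) (use step_fun_M_plus[OF d] in \<open>auto simp: M_plus_def\<close>)
  also have "\<dots> = ennreal (1 - \<theta>) * N (step_fun d n v) + ennreal \<theta> * N (step_fun d n v)"
    using \<theta> by (simp add: P1_homogeneous step_fun_M_plus d norm_step_fun_swap[OF d jk])
  also have "\<dots> = N (step_fun d n v)"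
    using \<theta> by (simp add: distrib_right[symmetric] ennreal_plus[symmetric])
  finally show ?thesis .
qed

text \<open>The transfer between the last \<open>j\<close> with \<open>a j < b j\<close> before the first \<open>k\<close> with \<open>b k < a k\<close>
  preserves the domination of the partial sums and creates a new index where \<open>a\<close> and \<open>b\<close> agree;
  \<open>b\<close> need not be sorted.\<close>

lemma norm_step_fun_majorization:
  assumes d: "0 < d"
    and a: "\<And>i. i < n \<Longrightarrow> 0 \<le> a i" "\<And>i j. i \<le> j \<Longrightarrow> j < n \<Longrightarrow> a j \<le> a i"
    and b: "\<And>i. i < n \<Longrightarrow> 0 \<le> b i"
    and major: "\<And>l. l \<le> n \<Longrightarrow> (\<Sum>i<l. a i) \<le> (\<Sum>i<l. b i)"
  shows "N (step_fun d n a) \<le> N (step_fun d n b)"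
  using b major
proof (induction "card {i. i < n \<and> a i \<noteq> b i}" arbitrary: b rule: less_induct)
  case less
  show ?case
  proof (cases "\<forall>i<n. a i \<le> b i")
    case True
    then show ?thesis by (intro P2 step_fun_M_plus d AE_I2 step_fun_mono) auto
  next
    case False
    define k where "k = (LEAST k. k < n \<and> b k < a k)"
    have k: "k < n" "b k < a k"
      using LeastI_ex[of "\<lambda>k. k < n \<and> b k < a k"] False by (auto simp: k_def not_le)
    have le: "a i \<le> b i" if "i < k" for i
      using not_less_Least[of i "\<lambda>k. k < n \<and> b k < a k"] that k by (auto simp: k_def[symmetric])
    \<comment> \<open>Otherwise \<open>a\<close> and \<open>b\<close> agree before \<open>k\<close>,
      and \<open>b k < a k\<close> violates the domination of the partial sums of length
      \<open>k + 1\<close>.\<close>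
    have ex: "\<exists>j<k. a j < b j"
    proof (rule ccontr)
      assume "\<not> ?thesis"
      with le have "\<forall>j<k. a j = b j" by force
      then have "(\<Sum>i<Suc k. b i) < (\<Sum>i<Suc k. a i)" using k by simp
      with less.prems(2)[of "Suc k"] k show False by simp
    qed
    define j where "j = (GREATEST j. j < k \<and> a j < b j)"
    have j: "j < k" "a j < b j"
      using GreatestI_ex_nat[of "\<lambda>j. j < k \<and> a j < b j" k] ex by (auto simp: j_def)
    have eq: "a i = b i" if "j < i" "i < k" for i
      using Greatest_le_nat[of "\<lambda>j. j < k \<and> a j < b j" i k] that le[of i]
      by (force simp: j_def[symmetric])
    \<comment> \<open>The largest amount that overshoots neither target. It makes the vectors agree
      at \<open>j\<close> or at \<open>k\<close>, which lowers the induction measure.\<close>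
    define e where "e = min (b j - a j) (a k - b k)"
    have e: "0 < e" "e \<le> b j - a j" "e \<le> a k - b k" using j k by (auto simp: e_def)
    \<comment> \<open>Sortedness of \<open>a\<close> makes the transfer admissible:
      \<open>b j - e \<ge> a j \<ge> a k \<ge> b k + e\<close>.\<close>
    have ajk: "a k \<le> a j" using a(2)[of j k] j k by simp
    define b' where "b' = b(j := b j - e, k := b k + e)"
    have b'_eq: "b' i = (if i = j then b j - e else if i = k then b k + e else b i)" for i
      using j by (auto simp: b'_def)
    have "{i. i < n \<and> a i \<noteq> b' i} \<subset> {i. i < n \<and> a i \<noteq> b i}"
    proof -
      have "a j = b' j \<or> a k = b' k" using j e_def by (auto simp: b'_eq min_def)
      moreover have "{i. i < n \<and> a i \<noteq> b' i} \<subseteq> {i. i < n \<and> a i \<noteq> b i}"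
        using j k by (auto simp: b'_eq split: if_splits)
      ultimately show ?thesis using j k by force
    qed
    then have "card {i. i < n \<and> a i \<noteq> b' i} < card {i. i < n \<and> a i \<noteq> b i}"
      by (intro psubset_card_mono) auto
    moreover have "0 \<le> b' i" if "i < n" for i
      using less.prems(1)[OF that] less.prems(1)[OF k(1)] e a(1)[of j] j k by (auto simp: b'_eq)
    moreover have "(\<Sum>i<l. a i) \<le> (\<Sum>i<l. b' i)" if "l \<le> n" for l
    proof -
      have "(\<Sum>i<l. b' i) = (\<Sum>i<l. b i - (if i = j then e else 0) + (if i = k then e else 0))"
        using j by (intro sum.cong) (auto simp: b'_eq)
      also have "\<dots> = (\<Sum>i<l. b i) - (if j < l then e else 0) + (if k < l then e else 0)"
        by (simp add: sum.distrib sum_subtractf)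
      finally have sum_b': "(\<Sum>i<l. b' i)
          = (\<Sum>i<l. b i) - (if j < l then e else 0) + (if k < l then e else 0)" .
      show ?thesis
      \<comment> \<open>Only these partial sums of \<open>b\<close> drop. For them every term of
        \<open>a\<close> is at most that of \<open>b\<close>, and the surplus at \<open>j\<close>
        alone is at least \<open>e\<close>.\<close>
      proof (cases "j < l \<and> l \<le> k")
        case True
        have "(\<Sum>i<l. a i) + e \<le> (\<Sum>i<l. b i)"
        proof -
          have "(\<Sum>i<l. a i + (if i = j then e else 0)) \<le> (\<Sum>i<l. b i)"
            using True le e by (intro sum_mono) auto
          then show ?thesis using True by (simp add: sum.distrib)
        qed
        then show ?thesis using True sum_b' by simp
      next
        case False
        then show ?thesis using j less.prems(2)[OF that] sum_b' by auto
      qed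
    qed
    ultimately have "N (step_fun d n a) \<le> N (step_fun d n b')"
      by (rule less.hyps)
    also have "\<dots> \<le> N (step_fun d n b)"
      unfolding b'_def
      by (rule norm_step_fun_transfer[OF d]) (use j k e ajk less.prems(1) in auto)
    finally show ?thesis .
  qed
qed

end

section \<open>Non-increasing functions and integrals over half-open intervals\<close>

lemma antimono_on_halflineD:
  fixes f :: "real \<Rightarrow> ennreal"
  shows "antimono_on {0<..} f \<Longrightarrow> 0 < x \<Longrightarrow> x \<le> y \<Longrightarrow> f y \<le> f x"
  using monotone_onD[of "{0<..}" "(\<le>)" "(\<ge>)" f x y] by simp

text \<open>Superlevel sets are initial intervals of the half-line, with or without their right end.
  Through \<open>antimono_H_op\<close> this also gives the measurability of the images of the
  operator.\<close>

lemma antimono_M_plus: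
  assumes "antimono_on {0<..} f"
  shows "f \<in> M_plus"
  unfolding M_plus_def
proof (rule borel_measurableI_greater)
  fix y
  define S where "S = {x \<in> space halfline. y < f x}"
  have down: "z \<in> S" if "x \<in> S" "0 < z" "z \<le> x" for x z
    using that antimono_on_halflineD[OF assms, of z x] by (auto simp: S_def)
  have S_sub: "S \<subseteq> {0<..}" by (auto simp: S_def)
  have "S \<in> sets borel"
  proof (cases "bdd_above S \<and> S \<noteq> {}")
    case True
    have "{0<..<Sup S} \<subseteq> S"
    proof
      fix x assume "x \<in> {0<..<Sup S}"
      moreover from this True obtain y where "y \<in> S" "x < y" by (auto simp: less_cSup_iff)
      ultimately show "x \<in> S" using down[of y x] by simp
    qed
    moreover have "S \<subseteq> {0<..Sup S}"
      using True S_sub by (auto intro: cSup_upper)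
    ultimately have "S = {0<..<Sup S} \<union> S \<inter> {Sup S}"
      by (auto simp: order_le_less)
    moreover have "S \<inter> {Sup S} \<in> sets borel"
      by (cases "Sup S \<in> S") auto
    ultimately show ?thesis by (metis borel_open open_greaterThanLessThan sets.Un)
  next
    case False
    have "S = {} \<or> S = {0<..}"
    proof (cases "S = {}")
      case nonempty: False
      have "z \<in> S" if "0 < z" for z
      proof -
        from False nonempty obtain x where "x \<in> S" "z \<le> x"
          by (auto simp: bdd_above_def) (meson linear)
        then show ?thesis using down that by blast
      qed
      then show ?thesis using S_sub by auto
    qed simp
    then show ?thesis by auto
  qed
  then show "{x \<in> space halfline. y < f x} \<in> sets halfline"
    using S_sub unfolding S_def by (intro sets_halfline_borel) auto
qed

lemma nn_integral_Ioc_split: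
  assumes "g \<in> M_plus" "0 \<le> a" "a \<le> b" "b \<le> c"
  shows "(\<integral>\<^sup>+t\<in>{a<..c}. g t \<partial>halfline)
    = (\<integral>\<^sup>+t\<in>{a<..b}. g t \<partial>halfline) + (\<integral>\<^sup>+t\<in>{b<..c}. g t \<partial>halfline)"
proof -
  have [measurable]: "g \<in> borel_measurable halfline" using assms by (simp add: M_plus_def)
  have [measurable]: "{a<..b} \<in> sets halfline" "{b<..c} \<in> sets halfline"
    using assms by (auto intro!: sets_halfline_borel)
  have "(\<integral>\<^sup>+t\<in>{a<..c}. g t \<partial>halfline)
     = (\<integral>\<^sup>+t. g t * indicator {a<..b} t + g t * indicator {b<..c} t \<partial>halfline)"
    using assms by (intro nn_integral_cong) (auto simp: indicator_def)
  then show ?thesis by (simp add: nn_integral_add)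
qed

lemma nn_integral_Ioc_upper:
  assumes "0 \<le> a" "a \<le> b" "\<And>t. a < t \<Longrightarrow> t \<le> b \<Longrightarrow> g t \<le> c"
  shows "(\<integral>\<^sup>+t\<in>{a<..b}. g t \<partial>halfline) \<le> c * ennreal (b - a)"
proof -
  have [measurable]: "{a<..b} \<in> sets halfline" using assms by (auto intro!: sets_halfline_borel)
  have "(\<integral>\<^sup>+t\<in>{a<..b}. g t \<partial>halfline) \<le> (\<integral>\<^sup>+t. c * indicator {a<..b} t \<partial>halfline)"
    using assms by (intro nn_integral_mono) (auto simp: indicator_def)
  then show ?thesis by (simp add: nn_integral_cmult emeasure_halfline_Ioc assms)
qed

lemma nn_integral_Ioc_lower:
  assumes "0 \<le> a" "a \<le> b" "\<And>t. a < t \<Longrightarrow> t \<le> b \<Longrightarrow> c \<le> g t"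
  shows "c * ennreal (b - a) \<le> (\<integral>\<^sup>+t\<in>{a<..b}. g t \<partial>halfline)"
proof -
  have [measurable]: "{a<..b} \<in> sets halfline" using assms by (auto intro!: sets_halfline_borel)
  have "(\<integral>\<^sup>+t. c * indicator {a<..b} t \<partial>halfline) \<le> (\<integral>\<^sup>+t\<in>{a<..b}. g t \<partial>halfline)"
    using assms by (intro nn_integral_mono) (auto simp: indicator_def)
  then show ?thesis by (simp add: nn_integral_cmult emeasure_halfline_Ioc assms)
qed

section \<open>Averages over blocks of indices\<close>

lemma sum_lessThan_add:
  fixes f :: "nat \<Rightarrow> real"
  shows "(\<Sum>i<a + b. f i) = (\<Sum>i<a. f i) + (\<Sum>i<b. f (a + i))"
  by (induction b) auto

text \<open>Both partial sums agree at multiples of \<open>K\<close>. Inside a block the average of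
  the first \<open>r\<close> terms is at least that of the whole block, since \<open>c r\<close>
  separates them from the remaining \<open>K - r\<close> terms.\<close>

lemma block_average_partial_sum_le:
  fixes b :: "nat \<Rightarrow> real"
  assumes K: "0 < K" and mono: "\<And>i j. i \<le> j \<Longrightarrow> b j \<le> b i"
  shows "(\<Sum>i<l. (\<Sum>j<K. b ((i div K) * K + j)) / real K) \<le> (\<Sum>i<l. b i)"
proof -
  define a where "a i = (\<Sum>j<K. b ((i div K) * K + j)) / real K" for i
  have a_block: "a (q * K + j) = (\<Sum>j<K. b (q * K + j)) / real K" if "j < K" for q j
    using that by (simp add: a_def)
  have full: "(\<Sum>i<q * K. a i) = (\<Sum>i<q * K. b i)" for q
  proof (induction q)
    case (Suc q)
    have "(\<Sum>i<K. a (q * K + i)) = (\<Sum>j<K. b (q * K + j))"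
      using K by (simp add: a_block)
    with Suc show ?case using sum_lessThan_add[of a "q * K" K] sum_lessThan_add[of b "q * K" K]
      by (simp add: add.commute)
  qed simp
  define q r where "q = l div K" and "r = l mod K"
  have l: "l = q * K + r" "r < K" using K by (auto simp: q_def r_def)
  have "(\<Sum>i<r. a (q * K + i)) \<le> (\<Sum>i<r. b (q * K + i))"
  proof -
    define c where "c j = b (q * K + j)" for j
    have c: "c j \<le> c i" if "i \<le> j" for i j using mono that by (simp add: c_def)
    have lower: "real r * c r \<le> (\<Sum>j<r. c j)"
      using sum_bounded_below[of "{..<r}" "c r" c] c by simp
    have "(\<Sum>j<K. c j) = (\<Sum>j<r. c j) + (\<Sum>j<K - r. c (r + j))"
      using sum_lessThan_add[of c r "K - r"] l by simp
    moreover have "(\<Sum>j<K - r. c (r + j)) \<le> real (K - r) * c r"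
      using sum_bounded_above[of "{..<K - r}" "\<lambda>j. c (r + j)" "c r"] c by simp
    ultimately have "(\<Sum>j<K. c j) \<le> (\<Sum>j<r. c j) + real (K - r) * c r" by simp
    then have "real r * (\<Sum>j<K. c j) \<le> real r * ((\<Sum>j<r. c j) + real (K - r) * c r)"
      by (intro mult_left_mono) auto
    also have "\<dots> = real r * (\<Sum>j<r. c j) + real (K - r) * (real r * c r)"
      by (simp add: algebra_simps)
    also have "\<dots> \<le> real r * (\<Sum>j<r. c j) + real (K - r) * (\<Sum>j<r. c j)"
      using lower by (intro add_left_mono mult_left_mono) auto
    also have "\<dots> = real K * (\<Sum>j<r. c j)"
      using l(2) by (simp add: distrib_right[symmetric] of_nat_diff)
    finally have "real r * ((\<Sum>j<K. c j) / real K) \<le> (\<Sum>j<r. c j)"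
      using K by (simp add: field_simps)
    moreover have "(\<Sum>i<r. a (q * K + i)) = real r * ((\<Sum>j<K. c j) / real K)"
      using l by (simp add: a_block c_def)
    ultimately show ?thesis by (simp add: c_def)
  qed
  then have "(\<Sum>i<l. a i) \<le> (\<Sum>i<l. b i)"
    unfolding l(1) sum_lessThan_add by (simp add: full)
  then show ?thesis by (simp add: a_def)
qed

lemma cell_ex:
  assumes "0 < d" "0 < x"
  obtains i where "x \<in> cell d i"
proof
  \<comment> \<open>A ceiling rather than a floor, because a right end belongs to its own cell and
    not to the next one.\<close>
  define i where "i = nat (\<lceil>x / d\<rceil> - 1)"
  have "0 < \<lceil>x / d\<rceil>" using assms by simp
  then have "real i = of_int \<lceil>x / d\<rceil> - 1" by (simp add: i_def)
  then have "real i < x / d" "x / d \<le> real i + 1" by linarith+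
  then show "x \<in> cell d i" using assms by (simp add: cell_def field_simps)
qed

lemma step_fun_tendsto:
  assumes "0 < d" "\<And>i. i < n \<Longrightarrow> (\<lambda>k. v k i) \<longlonglongrightarrow> w i"
  shows "(\<lambda>k. step_fun d n (v k) x) \<longlonglongrightarrow> step_fun d n w x"
proof (cases "\<exists>i<n. x \<in> cell d i")
  case True
  then obtain i where "i < n" "x \<in> cell d i" by blast
  with assms show ?thesis by (simp add: step_fun_cell tendsto_ennrealI)
next
  case False
  then show ?thesis using step_fun_outside[of n x d] by simp
qed

subsection \<open>The Hardy--Littlewood--Polya principle\<close>

context ri_banach_function_norm
begin

text \<open>\<open>P5\<close> makes \<open>g\<close> integrable over \<open>(0, x]\<close>, where
  \<open>g\<close> is at least \<open>g x\<close>. Hence \<open>g\<close> can be sampled by real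
  step functions although it may blow up at 0.\<close>

lemma antimono_finite:
  assumes g: "antimono_on {0<..} g" and fin: "N g < \<infinity>" and x: "0 < x"
  shows "g x < \<infinity>"
proof -
  have "g x * ennreal (x - 0) \<le> (\<integral>\<^sup>+t\<in>{0<..x}. g t \<partial>halfline)"
    using antimono_on_halflineD[OF g] x by (intro nn_integral_Ioc_lower) auto
  also have "\<dots> < \<infinity>"
    using x by (intro norm_finite_imp_integral_finite antimono_M_plus g fin) auto
  finally show ?thesis using x by (auto simp: ennreal_mult_less_top)
qed

text \<open>A block average of a non-increasing vector is majorized by the vector, which gives the
  contractivity of averaging over cells.\<close>

lemma norm_block_average_le:
  assumes g: "antimono_on {0<..} g" and fin: "N g < \<infinity>" and d: "0 < d" and K: "0 < K"
  defines "b \<equiv> \<lambda>j. enn2real (g (d / real K * (real j + 1)))"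
  shows "N (step_fun d n (\<lambda>i. (\<Sum>j<K. b (i * K + j)) / real K)) \<le> N g"
proof -
  define e where "e = d / real K"
  have e: "0 < e" "d = e * real K" using d K by (auto simp: e_def)
  have g_eq: "g x = ennreal (enn2real (g x))" if "0 < x" for x
    using antimono_finite[OF g fin that] by simp
  have b_nonneg: "0 \<le> b j" for j by (simp add: b_def)
  have b_mono: "b j \<le> b i" if "i \<le> j" for i j
  proof -
    have "e * (real i + 1) \<le> e * (real j + 1)" using that e by (intro mult_left_mono) auto
    moreover have pos: "0 < e * (real i + 1)" using e by simp
    ultimately have "g (e * (real j + 1)) \<le> g (e * (real i + 1))" by (intro antimono_on_halflineD[OF g])
    then show ?thesis unfolding b_def e_def[symmetric]
      using antimono_finite[OF g fin pos] by (intro enn2real_mono) auto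
  qed
  define \<alpha> where "\<alpha> i = (\<Sum>j<K. b (i * K + j)) / real K" for i
  have \<alpha>_nonneg: "0 \<le> \<alpha> i" for i using b_nonneg by (auto simp: \<alpha>_def intro!: divide_nonneg_nonneg sum_nonneg)
  have \<alpha>_mono: "\<alpha> j \<le> \<alpha> i" if "i \<le> j" for i j
    unfolding \<alpha>_def using that by (intro divide_right_mono sum_mono b_mono) auto
  \<comment> \<open>Majorization needs a common grid, so each value \<open>\<alpha> i\<close> is
    repeated on the \<open>K\<close> subcells of width \<open>e\<close>.\<close>
  have "N (step_fun d n \<alpha>) \<le> N (step_fun e (n * K) (\<lambda>i. \<alpha> (i div K)))"
  proof (intro P2 step_fun_M_plus d e AE_I2 step_fun_le)
    fix i x assume i: "i < n" and x: "x \<in> cell d i"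
    then have "0 < x" using cell_subset[OF d] by auto
    then obtain q where q: "x \<in> cell e q" using cell_ex[OF e(1)] by blast
    have "e * (real K * real i) < e * (real q + 1)" "e * real q < e * (real K * (real i + 1))"
      using x q unfolding cell_def e(2) by (auto simp: mult.assoc)
    then have "real K * real i < real q + 1" "real q < real K * (real i + 1)"
      using e by (auto simp: mult_less_cancel_left)
    then have *: "real (K * i) < real (Suc q)" "real q < real (K * Suc i)" by (auto simp: algebra_simps)
    then have **: "K * i \<le> q" "q < K * Suc i" by (auto simp del: of_nat_Suc of_nat_mult)
    then have "q div K = i" by (intro div_nat_eqI) (auto simp: mult.commute)
    moreover have "q < n * K"
      using ** mult_le_mono1[of "Suc i" n K] i by (simp add: mult.commute)
    ultimately show "ennreal (\<alpha> i) \<le> step_fun e (n * K) (\<lambda>i. \<alpha> (i div K)) x"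
      using step_fun_cell[OF e(1) _ q, of "n * K"] by simp
  qed
  also have "\<dots> \<le> N (step_fun e (n * K) b)"
    using block_average_partial_sum_le[of K b, OF K b_mono]
    by (intro norm_step_fun_majorization e b_nonneg \<alpha>_nonneg \<alpha>_mono div_le_mono) (auto simp: \<alpha>_def)
  also have "\<dots> \<le> N g"
  proof (intro P2 step_fun_M_plus e AE_I2 step_fun_le antimono_M_plus g)
    fix i x assume x: "x \<in> cell e i"
    then have "0 < x" "x \<le> e * (real i + 1)" using cell_subset[OF e(1), of i] by (auto simp: cell_def)
    then have "g (e * (real i + 1)) \<le> g x" by (intro antimono_on_halflineD[OF g])
    moreover have "0 < e * (real i + 1)" using e by simp
    ultimately show "ennreal (b i) \<le> g x"
      unfolding b_def e_def[symmetric] by (metis g_eq)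
  qed
  finally show ?thesis unfolding \<alpha>_def[abs_def] .
qed

text \<open>A limit of block averages of samples. On a subcell \<open>g\<close> is at most its value
  at the left end, which is the right end of the preceding subcell and hence a sample. The first
  subcell of a cell has no such sample inside the cell, and next to 0 \<open>g\<close> may be
  unbounded; \<open>\<beta>\<close> leaves this subcell out, and its width tends to 0.\<close>

lemma norm_cell_average_le:
  assumes g: "antimono_on {0<..} g" and fin: "N g < \<infinity>" and d: "0 < d"
  shows "N (step_fun d n (\<lambda>i. enn2real (\<integral>\<^sup>+t\<in>cell d i. g t \<partial>halfline) / d)) \<le> N g"
proof -
  have gM: "g \<in> M_plus" by (rule antimono_M_plus) fact
  then have [measurable]: "g \<in> borel_measurable halfline" by (simp add: M_plus_def)
  have int_fin: "(\<integral>\<^sup>+t\<in>{a<..b}. g t \<partial>halfline) < \<infinity>" if "0 \<le> a" for a b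
  proof (cases "a \<le> b")
    case True
    have "(\<integral>\<^sup>+t\<in>{a<..b}. g t \<partial>halfline) \<le> (\<integral>\<^sup>+t\<in>{0<..b}. g t \<partial>halfline)"
      using that by (intro nn_integral_mono) (auto simp: indicator_def)
    also have "\<dots> < \<infinity>" using that True by (intro norm_finite_imp_integral_finite gM fin) auto
    finally show ?thesis .
  qed simp
  define \<beta> where "\<beta> k i =
    enn2real (\<integral>\<^sup>+t\<in>{d * real i + d / real (Suc k) <.. d * (real i + 1)}. g t \<partial>halfline) / d" for k i
  have "N (step_fun d n (\<beta> k)) \<le> N g" for k
  proof -
    define K where "K = Suc k"
    define e where "e = d / real K"
    have e: "0 < e" "d = e * real K" using d by (auto simp: e_def K_def)
    define b where "b j = enn2real (g (e * (real j + 1)))" for j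
    have b_nonneg: "0 \<le> b j" for j by (simp add: b_def)
    have riemann: "(\<integral>\<^sup>+t\<in>{e * (real p + 1) <.. e * (real (p + r) + 1)}. g t \<partial>halfline)
        \<le> ennreal (e * (\<Sum>j<r. b (p + j)))" for p r
    proof (induction r)
      case (Suc r)
      let ?x = "e * (real (p + r) + 1)" and ?y = "e * (real (p + Suc r) + 1)"
      have pos: "0 < ?x" using e by simp
      have xy: "?x \<le> ?y" "?y - ?x = e" using e by (auto simp: algebra_simps)
      have "(\<integral>\<^sup>+t\<in>{e * (real p + 1) <.. ?y}. g t \<partial>halfline)
          = (\<integral>\<^sup>+t\<in>{e * (real p + 1) <.. ?x}. g t \<partial>halfline) + (\<integral>\<^sup>+t\<in>{?x <.. ?y}. g t \<partial>halfline)"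
        using e xy by (intro nn_integral_Ioc_split gM) auto
      also have "\<dots> \<le> ennreal (e * (\<Sum>j<r. b (p + j))) + g ?x * ennreal (?y - ?x)"
        using antimono_on_halflineD[OF g] pos xy
        by (intro add_mono Suc nn_integral_Ioc_upper) auto
      also have "g ?x = ennreal (b (p + r))"
        using antimono_finite[OF g fin pos] by (simp add: b_def)
      also have "ennreal (e * (\<Sum>j<r. b (p + j))) + ennreal (b (p + r)) * ennreal (?y - ?x)
          = ennreal (e * (\<Sum>j<Suc r. b (p + j)))"
        unfolding xy using e b_nonneg
        by (simp add: ennreal_mult[symmetric] ennreal_plus[symmetric] sum_nonneg algebra_simps
            del: ennreal_plus)
      finally show ?case .
    qed simp
    have "\<beta> k i \<le> (\<Sum>j<K. b (i * K + j)) / real K" for i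
    proof -
      have "d * real i + d / real (Suc k) = e * (real (i * K) + 1)"
        "d * (real i + 1) = e * (real (i * K + k) + 1)"
        using d by (auto simp: e_def K_def field_simps)
      then have "\<beta> k i \<le> enn2real (ennreal (e * (\<Sum>j<k. b (i * K + j)))) / d"
        unfolding \<beta>_def using riemann[of "i * K" k] d by (auto intro!: divide_right_mono enn2real_mono)
      also have "\<dots> = e * (\<Sum>j<k. b (i * K + j)) / d"
        using e b_nonneg by (simp add: sum_nonneg)
      also have "\<dots> = (\<Sum>j<k. b (i * K + j)) / real K"
        using d by (simp add: e_def)
      also have "\<dots> \<le> (\<Sum>j<K. b (i * K + j)) / real K"
        using b_nonneg by (auto simp: K_def intro!: divide_right_mono)
      finally show ?thesis .
    qed
    then have "N (step_fun d n (\<beta> k)) \<le> N (step_fun d n (\<lambda>i. (\<Sum>j<K. b (i * K + j)) / real K))"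
      by (intro P2 step_fun_M_plus d AE_I2 step_fun_mono)
    also have "\<dots> \<le> N g"
      using norm_block_average_le[OF g fin d, of K n] by (simp add: b_def e_def K_def)
    finally show ?thesis .
  qed
  moreover have "(\<lambda>k. \<beta> k i) \<longlonglongrightarrow> enn2real (\<integral>\<^sup>+t\<in>cell d i. g t \<partial>halfline) / d" for i
  proof -
    define A where "A k = {d * real i + d / real (Suc k) <.. d * (real i + 1)}" for k
    have A: "A k \<in> sets halfline" for k
      using d unfolding A_def by (intro sets_halfline_borel) (auto intro: le_less_trans[rotated])
    have "(\<lambda>k. emeasure (density halfline g) (A k)) \<longlonglongrightarrow> emeasure (density halfline g) (\<Union>k. A k)"
    proof (rule Lim_emeasure_incseq)
      show "incseq A"
      proof (intro incseq_SucI)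
        fix k
        have "d / real (Suc (Suc k)) \<le> d / real (Suc k)" using d by (intro divide_left_mono) auto
        then show "A k \<subseteq> A (Suc k)" by (auto simp: A_def)
      qed
    qed (use A in auto)
    moreover have "(\<Union>k. A k) = cell d i"
    proof (intro set_eqI iffI)
      fix x assume "x \<in> (\<Union>k. A k)"
      then show "x \<in> cell d i" using d by (auto simp: A_def cell_def intro: le_less_trans[rotated])
    next
      fix x assume x: "x \<in> cell d i"
      then have "0 < (x - d * real i) / d" using d by (simp add: cell_def)
      then obtain k where "inverse (real (Suc k)) < (x - d * real i) / d"
        using reals_Archimedean by blast
      then have "d / real (Suc k) < x - d * real i" using d by (simp add: field_simps)
      then have "x \<in> A k" using x by (simp add: A_def cell_def)
      then show "x \<in> (\<Union>k. A k)" by blast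
    qed
    ultimately have "(\<lambda>k. \<integral>\<^sup>+t\<in>A k. g t \<partial>halfline) \<longlonglongrightarrow> (\<integral>\<^sup>+t\<in>cell d i. g t \<partial>halfline)"
      using A sets_cell[OF d] by (simp add: emeasure_density)
    moreover have "(\<integral>\<^sup>+t\<in>cell d i. g t \<partial>halfline) < \<infinity>"
      unfolding cell_def using d by (intro int_fin) auto
    ultimately have "(\<lambda>k. enn2real (\<integral>\<^sup>+t\<in>A k. g t \<partial>halfline)) \<longlonglongrightarrow> enn2real (\<integral>\<^sup>+t\<in>cell d i. g t \<partial>halfline)"
      by (intro tendsto_enn2real) auto
    then show ?thesis unfolding \<beta>_def A_def by (intro tendsto_divide) (use d in auto)
  qed
  then have "AE x in halfline. (\<lambda>k. step_fun d n (\<beta> k) x)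
      \<longlonglongrightarrow> step_fun d n (\<lambda>i. enn2real (\<integral>\<^sup>+t\<in>cell d i. g t \<partial>halfline) / d) x"
    by (intro AE_I2 step_fun_tendsto d)
  ultimately show ?thesis
    by (rule norm_le_of_tendsto[OF step_fun_M_plus[OF d] step_fun_M_plus[OF d], rotated])
qed

text \<open>On a grid, \<open>f\<close> is replaced by its values at right ends and \<open>g\<close>
  by its cell averages. Times the cell width, the partial sums of the former are at most integrals
  of \<open>f\<close> and those of the latter equal integrals of \<open>g\<close>, so the hypothesis
  at grid points gives the majorization. The Fatou property then removes the grid.\<close>

theorem hardy_littlewood_polya:
  assumes f: "antimono_on {0<..} f" and g: "antimono_on {0<..} g"
    and le: "\<And>y. 0 < y \<Longrightarrow> (\<integral>\<^sup>+t\<in>{0<..y}. f t \<partial>halfline) \<le> (\<integral>\<^sup>+t\<in>{0<..y}. g t \<partial>halfline)"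
  shows "N f \<le> N g"
proof (cases "N g < \<infinity>")
  case False
  then show ?thesis by (simp add: less_top[symmetric])
next
  case fin: True
  have gM: "g \<in> M_plus" and fM: "f \<in> M_plus" using antimono_M_plus f g by auto
  have int_fin: "(\<integral>\<^sup>+t\<in>{0<..b}. g t \<partial>halfline) < \<infinity>" if "0 \<le> b" for b
    using that by (intro norm_finite_imp_integral_finite gM fin)
  have f_fin: "f x < \<infinity>" if "0 < x" for x
  proof -
    have "f x * ennreal (x - 0) \<le> (\<integral>\<^sup>+t\<in>{0<..x}. f t \<partial>halfline)"
      using antimono_on_halflineD[OF f] that by (intro nn_integral_Ioc_lower) auto
    also have "\<dots> \<le> (\<integral>\<^sup>+t\<in>{0<..x}. g t \<partial>halfline)" using le that by simp
    also have "\<dots> < \<infinity>" using int_fin that by simp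
    finally show ?thesis using that by (auto simp: ennreal_mult_less_top)
  qed
  define h where "h x = enn2real (f x)" for x
  have f_eq: "f x = ennreal (h x)" if "0 < x" for x using f_fin[OF that] by (simp add: h_def)
  have h_mono: "h y \<le> h x" if "0 < x" "x \<le> y" for x y
    unfolding h_def using that f_fin antimono_on_halflineD[OF f that] by (intro enn2real_mono) auto
  \<comment> \<open>With \<open>Suc k * Suc k\<close> cells of this width the grid covers
    \<open>(0, k + 1]\<close>, so it refines and exhausts the half-line at once.\<close>
  define d where "d k = 1 / real (Suc k)" for k
  define a where "a k i = h (d k * (real i + 1))" for k i
  have d: "0 < d k" for k by (simp add: d_def)
  have int_cells: "(\<integral>\<^sup>+t\<in>{0<..d k * real l}. g t \<partial>halfline) = (\<Sum>i<l. \<integral>\<^sup>+t\<in>cell (d k) i. g t \<partial>halfline)"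
    for k l
  proof (induction l)
    case (Suc l)
    have "d k * real l \<le> d k * real (Suc l)" using d[of k] by (intro mult_left_mono) auto
    then show ?case
      using nn_integral_Ioc_split[OF gM, of 0 "d k * real l" "d k * real (Suc l)"] Suc d[of k]
      by (simp add: cell_def add.commute)
  qed simp
  have "N (step_fun (d k) (Suc k * Suc k) (a k)) \<le> N g" for k
  proof -
    define b where "b i = enn2real (\<integral>\<^sup>+t\<in>cell (d k) i. g t \<partial>halfline) / d k" for i
    have b: "ennreal (d k * b i) = (\<integral>\<^sup>+t\<in>cell (d k) i. g t \<partial>halfline)" for i
    proof -
      have "(\<integral>\<^sup>+t\<in>cell (d k) i. g t \<partial>halfline) \<le> (\<integral>\<^sup>+t\<in>{0<..d k * (real i + 1)}. g t \<partial>halfline)"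
        using cell_subset[OF d] by (intro nn_integral_mono) (auto simp: indicator_def cell_def)
      also have "\<dots> < \<infinity>" using d[of k] by (intro int_fin) simp
      finally show ?thesis using d[of k] by (simp add: b_def)
    qed
    have b_nonneg: "0 \<le> b i" for i using d[of k] by (simp add: b_def)
    have a_nonneg: "0 \<le> a k i" for i by (simp add: a_def h_def)
    have "(\<Sum>i<l. a k i) \<le> (\<Sum>i<l. b i)" for l
    proof (cases "l = 0")
      case False
      have "ennreal (d k * (\<Sum>i<l. a k i)) \<le> (\<integral>\<^sup>+t\<in>{0<..d k * real l}. f t \<partial>halfline)"
      proof (induction l)
        case (Suc l)
        have le': "d k * real l \<le> d k * real (Suc l)" using d[of k] by (intro mult_left_mono) auto
        have "ennreal (d k * (\<Sum>i<Suc l. a k i))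
            = ennreal (d k * (\<Sum>i<l. a k i)) + ennreal (a k l) * ennreal (d k * real (Suc l) - d k * real l)"
          using d[of k] a_nonneg
          by (simp add: ennreal_mult[symmetric] ennreal_plus[symmetric] sum_nonneg algebra_simps
            del: ennreal_plus)
        also have "\<dots> \<le> (\<integral>\<^sup>+t\<in>{0<..d k * real l}. f t \<partial>halfline)
            + (\<integral>\<^sup>+t\<in>{d k * real l<..d k * real (Suc l)}. f t \<partial>halfline)"
        proof (intro add_mono Suc nn_integral_Ioc_lower le')
          fix t assume t: "d k * real l < t" "t \<le> d k * real (Suc l)"
          moreover have "0 \<le> d k * real l" using d[of k] by simp
          ultimately have "0 < t" by linarith
          then show "ennreal (a k l) \<le> f t"
            using t h_mono[of t "d k * (1 + real l)"] by (simp add: f_eq a_def add.commute ennreal_leI)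
        qed (use d[of k] in simp)
        also have "\<dots> = (\<integral>\<^sup>+t\<in>{0<..d k * real (Suc l)}. f t \<partial>halfline)"
          using le' d[of k] by (intro nn_integral_Ioc_split[symmetric] fM) auto
        finally show ?case .
      qed simp
      also have "\<dots> \<le> (\<integral>\<^sup>+t\<in>{0<..d k * real l}. g t \<partial>halfline)"
        using d[of k] False by (intro le) simp
      also have "\<dots> = ennreal (d k * (\<Sum>i<l. b i))"
        using d[of k] b_nonneg
        by (simp add: int_cells b[symmetric] sum_distrib_left sum_nonneg sum_ennreal)
      finally have "d k * (\<Sum>i<l. a k i) \<le> d k * (\<Sum>i<l. b i)"
        using d[of k] b_nonneg by (simp add: ennreal_le_iff sum_nonneg)
      then show ?thesis using d[of k] by simp
    qed simp
    moreover have "a k j \<le> a k i" if "i \<le> j" for i j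
      unfolding a_def using d[of k] that by (intro h_mono) auto
    ultimately have "N (step_fun (d k) (Suc k * Suc k) (a k)) \<le> N (step_fun (d k) (Suc k * Suc k) b)"
      by (intro norm_step_fun_majorization d a_nonneg b_nonneg)
    also have "\<dots> \<le> N g"
      unfolding b_def by (rule norm_cell_average_le[OF g fin d])
    finally show ?thesis .
  qed
  moreover have "AE x in halfline. (\<lambda>k. step_fun (d k) (Suc k * Suc k) (a k) x) \<longlonglongrightarrow> f x"
  proof -
    \<comment> \<open>The samples converge where \<open>h\<close> is continuous, which fails only
      countably often. The sign makes the function non-decreasing.\<close>
    define D where "D = {x \<in> {0<..}. \<not> isCont (\<lambda>x. - h x) x}"
    have "countable D"
      unfolding D_def using h_mono by (intro mono_on_ctble_discont_open) (auto intro!: mono_onI)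
    then have "D \<in> null_sets lebesgue"
      by (metis countable_imp_null_set_lborel null_sets_completionI)
    then have "AE x in lebesgue. x \<notin> D" by (rule AE_not_in)
    then have "AE x in halfline. x \<notin> D"
      by (subst AE_restrict_space_iff) auto
    moreover have "(\<lambda>k. step_fun (d k) (Suc k * Suc k) (a k) x) \<longlonglongrightarrow> f x" if "0 < x" "x \<notin> D" for x
    proof -
      have "isCont (\<lambda>x. - h x) x" using that by (simp add: D_def)
      from isCont_minus[OF this] have cont: "isCont h x" by simp
      have "\<exists>i. x \<in> cell (d k) i" for k using cell_ex[OF d that(1)] by metis
      then obtain i where i: "\<And>k. x \<in> cell (d k) (i k)" by metis
      define y where "y k = d k * (real (i k) + 1)" for k
      have y: "x \<le> y k" "y k \<le> x + d k" for k
        using i[of k] by (auto simp: y_def cell_def algebra_simps)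
      have "(\<lambda>k. x + d k) \<longlonglongrightarrow> x + 0"
        unfolding d_def by (intro tendsto_add tendsto_const lim_1_over_n[THEN LIMSEQ_Suc])
      then have "y \<longlonglongrightarrow> x"
        using y by (intro tendsto_sandwich[of "\<lambda>_. x" y _ "\<lambda>k. x + d k"]) auto
      then have "(\<lambda>k. h (y k)) \<longlonglongrightarrow> h x" by (rule isCont_tendsto_compose[OF cont])
      then have "(\<lambda>k. ennreal (h (y k))) \<longlonglongrightarrow> f x"
        unfolding f_eq[OF that(1)] by (rule tendsto_ennrealI)
      moreover have "eventually (\<lambda>k. ennreal (h (y k)) = step_fun (d k) (Suc k * Suc k) (a k) x) sequentially"
      proof -
        obtain n :: nat where n: "x < real n" using reals_Archimedean2 by blast
        have "ennreal (h (y k)) = step_fun (d k) (Suc k * Suc k) (a k) x" if "n \<le> k" for k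
        proof -
          have "d k * real (i k) < real (Suc k)"
            using i[of k] n that by (auto simp: cell_def)
          then have "real (i k) < real (Suc k * Suc k)"
            by (simp add: d_def field_simps)
          then have "i k < Suc k * Suc k" by (simp only: of_nat_less_iff)
          then show ?thesis using step_fun_cell[OF d _ i] by (simp add: a_def y_def)
        qed
        then show ?thesis by (auto simp: eventually_sequentially)
      qed
      ultimately show ?thesis by (rule Lim_transform_eventually)
    qed
    ultimately show ?thesis by (elim AE_mp) (rule AE_I2, simp)
  qed
  ultimately show ?thesis
    by (rule norm_le_of_tendsto[OF step_fun_M_plus[OF d] fM, rotated])
qed

end

subsection \<open>Decreasing rearrangement\<close>

text \<open>Equal to the more usual infimum of all \<open>s \<ge> 0\<close> with
  \<open>distribution_function f s \<le> ennreal t\<close>, as the distribution function is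
  non-increasing. The supremum suits strict superlevel sets.\<close>

definition rearrangement :: "(real \<Rightarrow> ennreal) \<Rightarrow> real \<Rightarrow> ennreal" where
  "rearrangement f t = (SUP s\<in>{s. 0 \<le> s \<and> ennreal t < distribution_function f s}. ennreal s)"

lemma antimono_rearrangement: "antimono_on {0<..} (rearrangement f)"
  unfolding rearrangement_def
  by (intro monotone_onI SUP_subset_mono) (auto intro: le_less_trans[OF ennreal_leI])

lemma sets_superlevel: "f \<in> M_plus \<Longrightarrow> {t \<in> {0<..}. c < f t} \<in> sets halfline"
  using measurable_sets[of f halfline borel "{c<..}"]
  by (simp add: M_plus_def vimage_def Int_def conj_commute)

lemma measurable_emeasure_superlevel:
  fixes g :: "_ \<Rightarrow> ennreal"
  assumes "sigma_finite_measure M" and [measurable]: "g \<in> borel_measurable M"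
  shows "(\<lambda>l. emeasure M {x \<in> space M. ennreal l < g x}) \<in> borel_measurable lborel"
proof -
  interpret sigma_finite_measure M by fact
  have "(\<lambda>l. \<integral>\<^sup>+x. indicator {x \<in> space M. ennreal l < g x} x \<partial>M) \<in> borel_measurable lborel"
    by (intro borel_measurable_nn_integral) (simp add: indicator_def)
  then show ?thesis by simp
qed

text \<open>The implication from right to left is right-continuity of the distribution function: the
  superlevel set at \<open>s\<close> is the increasing union of those at
  \<open>s + 1 / (n + 1)\<close>.\<close>

lemma less_rearrangement_iff:
  assumes f: "f \<in> M_plus" and s: "0 \<le> s"
  shows "ennreal s < rearrangement f t \<longleftrightarrow> ennreal t < distribution_function f s"
proof
  assume "ennreal s < rearrangement f t"
  then obtain s' where s': "0 \<le> s'" "ennreal t < distribution_function f s'" "ennreal s < ennreal s'"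
    unfolding rearrangement_def less_SUP_iff by auto
  have "distribution_function f s' \<le> distribution_function f s"
    unfolding distribution_function_def using s'
    by (intro emeasure_mono sets_superlevel f) (auto intro: less_trans)
  with s' show "ennreal t < distribution_function f s" by simp
next
  assume t: "ennreal t < distribution_function f s"
  define A where "A n = {t \<in> {0<..}. ennreal (s + 1 / real (Suc n)) < f t}" for n
  have "(\<Union>n. A n) = {t \<in> {0<..}. ennreal s < f t}"
  proof (intro set_eqI iffI)
    fix t assume "t \<in> (\<Union>n. A n)"
    then obtain n where "0 < t" "ennreal (s + 1 / real (Suc n)) < f t" by (auto simp: A_def)
    moreover have "ennreal s \<le> ennreal (s + 1 / real (Suc n))" by (intro ennreal_leI) simp
    ultimately show "t \<in> {t \<in> {0<..}. ennreal s < f t}" by simp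
  next
    fix t assume t: "t \<in> {t \<in> {0<..}. ennreal s < f t}"
    have "\<exists>n. ennreal (s + 1 / real (Suc n)) < f t"
    proof (cases "f t")
      case (real r)
      then have "0 < r - s" using t s by (simp add: ennreal_less_iff)
      then obtain n where "inverse (real (Suc n)) < r - s" using reals_Archimedean by blast
      then show ?thesis using real s
        by (intro exI[of _ n]) (simp add: ennreal_less_iff inverse_eq_divide del: ennreal_plus)
    qed simp
    then show "t \<in> (\<Union>n. A n)" using t by (simp add: A_def)
  qed
  moreover have "incseq A"
  proof (intro incseq_SucI subsetI)
    fix n t assume "t \<in> A n"
    moreover have "ennreal (s + 1 / real (Suc (Suc n))) \<le> ennreal (s + 1 / real (Suc n))"
      by (intro ennreal_leI add_left_mono divide_left_mono) auto
    ultimately show "t \<in> A (Suc n)" by (auto simp: A_def)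
  qed
  moreover have "range A \<subseteq> sets halfline"
    unfolding A_def using sets_superlevel[OF f] by blast
  ultimately have "distribution_function f s = (SUP n. emeasure halfline (A n))"
    unfolding distribution_function_def by (simp add: SUP_emeasure_incseq)
  with t obtain n where "ennreal t < emeasure halfline (A n)" by (auto simp: less_SUP_iff)
  then have "ennreal t < distribution_function f (s + 1 / real (Suc n))"
    by (simp add: distribution_function_def A_def)
  then have "ennreal (s + 1 / real (Suc n)) \<le> rearrangement f t"
    unfolding rearrangement_def using s by (intro SUP_upper) auto
  moreover have "ennreal s < ennreal (s + 1 / real (Suc n))" using s by (simp add: ennreal_less_iff)
  ultimately show "ennreal s < rearrangement f t" by (rule less_le_trans[rotated])
qed

lemma emeasure_halfline_less: "emeasure halfline {t \<in> {0<..}. ennreal t < c} = c"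
proof (cases c)
  case (real r)
  then have "{t \<in> {0<..}. ennreal t < c} = {0<..<r}" by (auto simp: ennreal_less_iff)
  moreover have "emeasure halfline {0<..<r} = ennreal r"
    using real by (subst emeasure_restrict_space) auto
  ultimately show ?thesis using real by simp
next
  case top
  have "ennreal (real n) \<le> emeasure halfline {0<..}" for n :: nat
    using emeasure_halfline_Ioc[of 0 "real n"] emeasure_mono[of "{0<..real n}" "{0<..}" halfline]
    by (force simp: sets_restrict_space_iff)
  then have "emeasure halfline {0<..} = top"
    by (metis ennreal_cases ennreal_le_iff not_le reals_Archimedean2)
  then show ?thesis using top by (simp add: greaterThan_def)
qed

text \<open>By \<open>less_rearrangement_iff\<close> the superlevel set of the rearrangement at
  \<open>s\<close> is an initial interval of length \<open>distribution_function f s\<close>,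
  possibly infinite.\<close>

lemma equimeasurable_rearrangement:
  assumes "f \<in> M_plus"
  shows "equimeasurable (rearrangement f) f"
  using assms emeasure_halfline_less
  by (simp add: equimeasurable_def less_rearrangement_iff distribution_function_def[of "rearrangement f"])

text \<open>Subtraction in \<open>ennreal\<close> truncates at 0, so the integrand is the positive
  part of \<open>f - c\<close>, and its level \<open>l\<close> is the level \<open>l + c\<close> of
  \<open>f\<close>.\<close>

lemma nn_integral_excess_distribution:
  assumes "f \<in> M_plus" "0 \<le> c"
  shows "(\<integral>\<^sup>+t. f t - ennreal c \<partial>halfline)
    = (\<integral>\<^sup>+l. indicator {0..} l * distribution_function f (l + c) \<partial>lborel)"
proof -
  have [measurable]: "f \<in> borel_measurable halfline" using assms by (simp add: M_plus_def)
  have "ennreal l < f t - ennreal c \<longleftrightarrow> ennreal (l + c) < f t" if "0 \<le> l" for l t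
    using assms(2) that by (simp add: less_diff_eq_ennreal)
  then show ?thesis
    by (subst nn_integral_layer_cake[OF sigma_finite_halfline])
      (auto simp: distribution_function_def indicator_def intro!: nn_integral_cong)
qed

lemma nn_integral_excess_equimeasurable:
  assumes "f \<in> M_plus" "g \<in> M_plus" "equimeasurable f g" "0 \<le> c"
  shows "(\<integral>\<^sup>+t. f t - ennreal c \<partial>halfline) = (\<integral>\<^sup>+t. g t - ennreal c \<partial>halfline)"
  using assms
  by (auto simp: nn_integral_excess_distribution equimeasurable_def indicator_def intro!: nn_integral_cong)

lemma nn_integral_Ioc_le_excess:
  assumes "f \<in> M_plus" "0 \<le> c" "0 \<le> y"
  shows "(\<integral>\<^sup>+t\<in>{0<..y}. f t \<partial>halfline) \<le> (\<integral>\<^sup>+t. f t - ennreal c \<partial>halfline) + ennreal (c * y)"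
proof -
  have [measurable]: "f \<in> borel_measurable halfline" "{0<..y} \<in> sets halfline"
    using assms by (auto simp: M_plus_def intro!: sets_halfline_borel)
  have "(\<integral>\<^sup>+t\<in>{0<..y}. f t \<partial>halfline)
      \<le> (\<integral>\<^sup>+t. (f t - ennreal c) + ennreal c * indicator {0<..y} t \<partial>halfline)"
  proof (intro nn_integral_mono)
    fix t
    have "f t \<le> (f t - ennreal c) + ennreal c"
      by (metis add_increasing diff_add_cancel_ennreal linear zero_le order_refl)
    then show "f t * indicator {0<..y} t \<le> (f t - ennreal c) + ennreal c * indicator {0<..y} t"
      by (auto simp: indicator_def)
  qed
  also have "\<dots> = (\<integral>\<^sup>+t. f t - ennreal c \<partial>halfline) + ennreal (c * y)"
    using assms by (simp add: nn_integral_add nn_integral_cmult emeasure_halfline_Ioc ennreal_mult)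
  finally show ?thesis .
qed

text \<open>The case of equality in \<open>nn_integral_Ioc_le_excess\<close>. A non-increasing
  \<open>f\<close> satisfies the conditions at the level \<open>f y\<close> if that value is finite,
  so minimising over \<open>c\<close> recovers the integral over \<open>(0, y]\<close>.\<close>

lemma nn_integral_Ioc_eq_excess:
  assumes f: "f \<in> M_plus" and c: "0 \<le> c" and y: "0 \<le> y"
    and ge: "\<And>t. 0 < t \<Longrightarrow> t \<le> y \<Longrightarrow> ennreal c \<le> f t" and le: "\<And>t. y < t \<Longrightarrow> f t \<le> ennreal c"
  shows "(\<integral>\<^sup>+t. f t - ennreal c \<partial>halfline) + ennreal (c * y) = (\<integral>\<^sup>+t\<in>{0<..y}. f t \<partial>halfline)"
proof -
  have [measurable]: "f \<in> borel_measurable halfline" "{0<..y} \<in> sets halfline"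
    using f y by (auto simp: M_plus_def intro!: sets_halfline_borel)
  have "(\<integral>\<^sup>+t\<in>{0<..y}. f t \<partial>halfline)
      = (\<integral>\<^sup>+t. (f t - ennreal c) + ennreal c * indicator {0<..y} t \<partial>halfline)"
  proof (intro nn_integral_cong)
    fix t assume "t \<in> space halfline"
    then show "f t * indicator {0<..y} t = (f t - ennreal c) + ennreal c * indicator {0<..y} t"
      using ge[of t] le[of t] le_less_trans[OF le[of t] ennreal_less_top]
      by (cases "t \<le> y") (auto simp: diff_add_cancel_ennreal diff_eq_0_ennreal)
  qed
  also have "\<dots> = (\<integral>\<^sup>+t. f t - ennreal c \<partial>halfline) + ennreal (c * y)"
    using c y by (simp add: nn_integral_add nn_integral_cmult emeasure_halfline_Ioc ennreal_mult)
  finally show ?thesis by simp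
qed

text \<open>The excess integrals over all levels are invariant under rearrangement and determine the
  integrals of the decreasing rearrangement over initial intervals by Legendre duality.\<close>

lemma (in ri_banach_function_norm) norm_le_of_excess_le:
  assumes u: "antimono_on {0<..} u" and f: "f \<in> M_plus"
    and le: "\<And>c. 0 < c \<Longrightarrow> (\<integral>\<^sup>+t. u t - ennreal c \<partial>halfline) \<le> (\<integral>\<^sup>+t. f t - ennreal c \<partial>halfline)"
  shows "N u \<le> N f"
proof -
  define g where "g = rearrangement f"
  have g: "antimono_on {0<..} g" "g \<in> M_plus" "equimeasurable g f"
    using antimono_rearrangement equimeasurable_rearrangement[OF f] antimono_M_plus
    by (auto simp: g_def)
  have "N u \<le> N g"
  proof (rule hardy_littlewood_polya[OF u g(1)])
    fix y :: real assume y: "0 < y"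
    show "(\<integral>\<^sup>+t\<in>{0<..y}. u t \<partial>halfline) \<le> (\<integral>\<^sup>+t\<in>{0<..y}. g t \<partial>halfline)"
    proof (cases "g y")
      case top
      have "g y * ennreal (y - 0) \<le> (\<integral>\<^sup>+t\<in>{0<..y}. g t \<partial>halfline)"
        using y antimono_on_halflineD[OF g(1)] by (intro nn_integral_Ioc_lower) auto
      with top y show ?thesis by (simp add: ennreal_top_mult top_unique)
    next
      case (real c)
      show ?thesis
      proof (rule ennreal_le_epsilon)
        fix e :: real assume e: "0 < e"
        \<comment> \<open>The hypothesis compares excess integrals at positive levels, while
          \<open>g y\<close> may be 0. Raising the level by \<open>\<epsilon>\<close> costs
          \<open>\<epsilon> * y = e\<close>.\<close>
        define \<epsilon> where "\<epsilon> = e / y"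
        have \<epsilon>: "0 < \<epsilon>" "\<epsilon> * y = e" using e y by (auto simp: \<epsilon>_def)
        have "(\<integral>\<^sup>+t\<in>{0<..y}. u t \<partial>halfline)
            \<le> (\<integral>\<^sup>+t. u t - ennreal (c + \<epsilon>) \<partial>halfline) + ennreal ((c + \<epsilon>) * y)"
          using real \<epsilon> y by (intro nn_integral_Ioc_le_excess antimono_M_plus u) auto
        also have "\<dots> \<le> (\<integral>\<^sup>+t. f t - ennreal (c + \<epsilon>) \<partial>halfline) + ennreal ((c + \<epsilon>) * y)"
          using real \<epsilon> by (intro add_right_mono le) auto
        also have "(\<integral>\<^sup>+t. f t - ennreal (c + \<epsilon>) \<partial>halfline) = (\<integral>\<^sup>+t. g t - ennreal (c + \<epsilon>) \<partial>halfline)"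
          using real \<epsilon> by (intro nn_integral_excess_equimeasurable[symmetric] g f) auto
        also have "\<dots> \<le> (\<integral>\<^sup>+t. g t - ennreal c \<partial>halfline)"
          using \<epsilon> by (intro nn_integral_mono ennreal_minus_mono ennreal_leI) auto
        also have "ennreal ((c + \<epsilon>) * y) = ennreal (c * y) + ennreal e"
          using real \<epsilon> e y by (simp add: distrib_right ennreal_plus)
        also have "(\<integral>\<^sup>+t. g t - ennreal c \<partial>halfline) + (ennreal (c * y) + ennreal e)
            = (\<integral>\<^sup>+t\<in>{0<..y}. g t \<partial>halfline) + ennreal e"
        proof -
          have "(\<integral>\<^sup>+t. g t - ennreal c \<partial>halfline) + ennreal (c * y) = (\<integral>\<^sup>+t\<in>{0<..y}. g t \<partial>halfline)"
            using real y by (intro nn_integral_Ioc_eq_excess g) (auto simp flip: real(2) intro: antimono_on_halflineD[OF g(1)])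
          then show ?thesis by (simp add: add.assoc[symmetric])
        qed
        finally show "(\<integral>\<^sup>+t\<in>{0<..y}. u t \<partial>halfline) \<le> (\<integral>\<^sup>+t\<in>{0<..y}. g t \<partial>halfline) + ennreal e"
          by (simp add: add_right_mono)
      qed
    qed
  qed
  also have "N g = N f" by (intro P6 g f)
  finally show ?thesis .
qed

text \<open>If \<open>h r > l\<close>, then \<open>c h > l\<close> on \<open>[r / 2, r]\<close>, hence on at least half of \<open>(a, r]\<close>.\<close>

lemma nn_integral_Ioc_doubling_le:
  assumes f: "f \<in> M_plus" and h: "h \<in> M_plus" and c: "0 \<le> c"
    and doubling: "\<And>s r. 0 < s \<Longrightarrow> s \<le> r \<Longrightarrow> r \<le> 2 * s \<Longrightarrow> h r \<le> ennreal c * h s"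
    and ab: "0 \<le> a" "a \<le> b" and k: "0 \<le> k"
    and avg: "\<And>y. a < y \<Longrightarrow> y \<le> b \<Longrightarrow> (\<integral>\<^sup>+t\<in>{a<..y}. f t \<partial>halfline) \<le> ennreal (k * (y - a))"
  shows "(\<integral>\<^sup>+t\<in>{a<..b}. f t * h t \<partial>halfline)
    \<le> ennreal (2 * k * c) * (\<integral>\<^sup>+t\<in>{a<..b}. h t \<partial>halfline)"
proof (cases "a = b")
  case False
  then have "a < b" using ab by simp
  have [measurable]: "f \<in> borel_measurable halfline" "h \<in> borel_measurable halfline"
    "{a<..b} \<in> sets halfline"
    using f h ab by (auto simp: M_plus_def intro!: sets_halfline_borel)
  \<comment> \<open>The layer cake of \<open>h\<close> under \<open>f dt\<close> is compared, level
    by level, with that of \<open>c h\<close> under length, both on \<open>(a, b]\<close>.\<close>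
  define \<nu> where "\<nu> = density halfline (\<lambda>t. f t * indicator {a<..b} t)"
  define \<eta> where "\<eta> = density halfline (indicator {a<..b})"
  have "emeasure \<nu> (space \<nu>) = (\<integral>\<^sup>+t\<in>{a<..b}. f t \<partial>halfline)"
    unfolding \<nu>_def by (subst emeasure_density) (auto intro!: nn_integral_cong)
  also have "\<dots> \<le> ennreal (k * (b - a))" using \<open>a < b\<close> by (intro avg) auto
  finally have "finite_measure \<nu>" by (intro finite_measureI) (auto simp: top_unique)
  then interpret \<nu>: finite_measure \<nu> .
  have "emeasure \<eta> (space \<eta>) = (\<integral>\<^sup>+t. indicator {a<..b} t \<partial>halfline)"
    unfolding \<eta>_def
    by (subst emeasure_density) (auto intro!: nn_integral_cong simp: indicator_def simp del: nn_integral_indicator)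
  then have "finite_measure \<eta>"
    using ab by (intro finite_measureI) (simp add: emeasure_halfline_Ioc)
  then interpret \<eta>: finite_measure \<eta> .
  have sp: "space \<nu> = {0<..}" "space \<eta> = {0<..}" by (auto simp: \<nu>_def \<eta>_def)
  have level: "emeasure \<nu> {t \<in> space \<nu>. ennreal l < h t}
      \<le> ennreal (2 * k) * emeasure \<eta> {t \<in> space \<eta>. ennreal l < ennreal c * h t}" if "0 \<le> l" for l
  proof -
    define U where "U = {t \<in> {a<..b}. ennreal l < h t}"
    have \<nu>U: "emeasure \<nu> {t \<in> space \<nu>. ennreal l < h t} = (\<integral>\<^sup>+t\<in>U. f t \<partial>halfline)"
    proof -
      have "emeasure \<nu> {t \<in> space \<nu>. ennreal l < h t}
          = (\<integral>\<^sup>+t\<in>{t \<in> {0<..}. ennreal l < h t}. f t * indicator {a<..b} t \<partial>halfline)"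
        unfolding sp unfolding \<nu>_def by (intro emeasure_density sets_superlevel h) measurable
      also have "\<dots> = (\<integral>\<^sup>+t\<in>U. f t \<partial>halfline)"
        by (intro nn_integral_cong) (auto simp: indicator_def U_def)
      finally show ?thesis .
    qed
    define V where "V = {t \<in> {a<..b}. ennreal l < ennreal c * h t}"
    have chM: "(\<lambda>t. ennreal c * h t) \<in> M_plus" by (simp add: M_plus_def)
    have "V = {t \<in> {0<..}. ennreal l < ennreal c * h t} \<inter> {a<..b}" using ab by (auto simp: V_def)
    then have V: "V \<in> sets halfline" using sets_superlevel[OF chM] by simp
    have \<eta>V: "emeasure \<eta> {t \<in> space \<eta>. ennreal l < ennreal c * h t} = emeasure halfline V"
    proof -
      have "emeasure \<eta> {t \<in> space \<eta>. ennreal l < ennreal c * h t}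
          = (\<integral>\<^sup>+t\<in>{t \<in> {0<..}. ennreal l < ennreal c * h t}. indicator {a<..b} t \<partial>halfline)"
        unfolding sp unfolding \<eta>_def by (intro emeasure_density sets_superlevel chM) measurable
      also have "\<dots> = (\<integral>\<^sup>+t. indicator V t \<partial>halfline)"
        by (intro nn_integral_cong) (auto simp: indicator_def V_def)
      finally show ?thesis using V by simp
    qed
    have half: "ennreal ((r - a) / 2) \<le> emeasure halfline V" if "r \<in> U" for r
    proof -
      have r: "a < r" "r \<le> b" "ennreal l < h r" using that by (auto simp: U_def)
      have "ennreal ((r - a) / 2) \<le> ennreal (r - max a (r / 2))"
        using r ab by (intro ennreal_leI) (simp add: max_def field_simps)
      also have "\<dots> = emeasure halfline {max a (r / 2)<..r}"
        using r ab by (subst emeasure_halfline_Ioc) auto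
      also have "\<dots> \<le> emeasure halfline V"
      proof (intro emeasure_mono V subsetI)
        fix t assume t: "t \<in> {max a (r / 2)<..r}"
        then have "h r \<le> ennreal c * h t" using ab by (intro doubling) auto
        with t r show "t \<in> V" by (auto simp: V_def)
      qed
      finally show ?thesis .
    qed
    show ?thesis
    proof (cases "U = {}")
      case True
      then show ?thesis unfolding \<nu>U by simp
    next
      case False
      \<comment> \<open>\<open>U\<close> need not be an interval, so the bound on averages is
        applied to its hull \<open>(a, Sup U]\<close>. The supremum may lie outside
        \<open>U\<close>, hence \<open>half\<close> is used at all points of \<open>U\<close> and
        passed to the limit.\<close>
      have bdd: "bdd_above U" by (auto simp: U_def bdd_above_def)
      have x: "a < Sup U" "Sup U \<le> b"
      proof -
        obtain r where "r \<in> U" using False by blast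
        then show "a < Sup U" using cSup_upper[OF _ bdd, of r] by (auto simp: U_def)
        show "Sup U \<le> b" using False by (intro cSup_least) (auto simp: U_def)
      qed
      have "(\<integral>\<^sup>+t\<in>U. f t \<partial>halfline) \<le> (\<integral>\<^sup>+t\<in>{a<..Sup U}. f t \<partial>halfline)"
        using cSup_upper[OF _ bdd] by (intro nn_integral_mono) (auto simp: indicator_def U_def)
      also have "\<dots> \<le> ennreal (k * (Sup U - a))" using x by (intro avg) auto
      also have "\<dots> = ennreal (2 * k) * ennreal ((Sup U - a) / 2)"
        using k x by (subst ennreal_mult[symmetric]) auto
      also have "ennreal ((Sup U - a) / 2) \<le> emeasure halfline V"
      proof (cases "emeasure halfline V")
        case (real e)
        have "r \<le> 2 * e + a" if "r \<in> U" for r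
          using half[OF that] real that by (simp add: U_def)
        then have "Sup U \<le> 2 * e + a" using False by (intro cSup_least)
        then show ?thesis using real by (simp add: ennreal_leI)
      qed simp
      finally show ?thesis unfolding \<nu>U \<eta>V by (simp add: mult_left_mono)
    qed
  qed
  have "(\<integral>\<^sup>+t\<in>{a<..b}. f t * h t \<partial>halfline) = (\<integral>\<^sup>+t. h t \<partial>\<nu>)"
    unfolding \<nu>_def by (subst nn_integral_density) (auto intro!: nn_integral_cong simp: ac_simps)
  also have "\<dots> = (\<integral>\<^sup>+l. indicator {0..} l * emeasure \<nu> {t \<in> space \<nu>. ennreal l < h t} \<partial>lborel)"
    by (intro nn_integral_layer_cake \<nu>.sigma_finite_measure_axioms) (simp add: \<nu>_def)
  also have "\<dots> \<le> (\<integral>\<^sup>+l. ennreal (2 * k) * (indicator {0..} l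
      * emeasure \<eta> {t \<in> space \<eta>. ennreal l < ennreal c * h t}) \<partial>lborel)"
    using level by (intro nn_integral_mono) (auto simp: indicator_def)
  also have "\<dots> = ennreal (2 * k) * (\<integral>\<^sup>+l. indicator {0..} l
      * emeasure \<eta> {t \<in> space \<eta>. ennreal l < ennreal c * h t} \<partial>lborel)"
    by (intro nn_integral_cmult borel_measurable_times_ennreal measurable_emeasure_superlevel
        \<eta>.sigma_finite_measure_axioms) (auto simp: \<eta>_def)
  also have "(\<integral>\<^sup>+l. indicator {0..} l
      * emeasure \<eta> {t \<in> space \<eta>. ennreal l < ennreal c * h t} \<partial>lborel) = (\<integral>\<^sup>+t. ennreal c * h t \<partial>\<eta>)"
    by (intro nn_integral_layer_cake[symmetric] \<eta>.sigma_finite_measure_axioms) (simp add: \<eta>_def)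
  also have "\<dots> = ennreal c * (\<integral>\<^sup>+t\<in>{a<..b}. h t \<partial>halfline)"
    unfolding \<eta>_def by (subst nn_integral_density)
      (auto intro!: nn_integral_cong simp: nn_integral_cmult[symmetric] ac_simps)
  finally show ?thesis using k c by (simp add: ennreal_mult mult.assoc)
qed simp

subsection \<open>Geometric approximation of the level function\<close>

text \<open>The point \<open>x k\<close> stands for a maximiser of \<open>(\<integral>\<^sub>0\<^sup>y f) - \<mu> k * y\<close>; only the resulting one-sided
  bounds on the averages of \<open>f\<close> are recorded.\<close>

locale staircase =
  fixes f :: "real \<Rightarrow> ennreal" and x \<mu> :: "nat \<Rightarrow> real" and \<rho> :: real
  assumes f: "f \<in> M_plus" and \<rho>: "1 < \<rho>"
    and x_0: "x 0 = 0" and x_Suc: "\<And>k. x k \<le> x (Suc k)"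
    and \<mu>_pos: "\<And>k. 0 < \<mu> k" and \<mu>_Suc: "\<And>k. \<mu> k = \<rho> * \<mu> (Suc k)"
    and upper: "\<And>k y. x k \<le> y \<Longrightarrow> (\<integral>\<^sup>+t\<in>{x k<..y}. f t \<partial>halfline) \<le> ennreal (\<mu> k * (y - x k))"
    and lower: "\<And>k. ennreal (\<mu> (Suc k) * (x (Suc k) - x k))
      \<le> (\<integral>\<^sup>+t\<in>{x k<..x (Suc k)}. f t \<partial>halfline)"
begin

text \<open>If the \<open>x k\<close> are maximisers, the concave majorant has slopes between
  \<open>\<mu> (Suc k)\<close> and \<open>\<mu> k\<close> on \<open>(x k, x (Suc k)]\<close>;
  \<open>stair\<close> takes the lower value there and is 0 beyond all \<open>x k\<close>. Writing
  it as a supremum makes monotonicity immediate.\<close>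

definition stair :: "real \<Rightarrow> ennreal" where
  "stair s = (SUP k. ennreal (\<mu> k) * indicator {..x k} s)"

lemma x_mono: "j \<le> k \<Longrightarrow> x j \<le> x k"
  by (rule lift_Suc_mono_le[of x]) (rule x_Suc)

lemma x_nonneg: "0 \<le> x k"
  using x_mono[of 0 k] x_0 by simp

lemma \<mu>_mono: "j \<le> k \<Longrightarrow> \<mu> k \<le> \<mu> j"
proof (rule lift_Suc_antimono_le[of \<mu>])
  fix k
  have "1 * \<mu> (Suc k) \<le> \<rho> * \<mu> (Suc k)" using \<rho> \<mu>_pos[of "Suc k"] by (intro mult_right_mono) auto
  then show "\<mu> (Suc k) \<le> \<mu> k" using \<mu>_Suc[of k] by simp
qed

lemma \<mu>_eventually_le:
  assumes "0 < c"
  obtains k where "\<mu> k \<le> c"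
proof -
  have "\<mu> 0 = \<rho> ^ k * \<mu> k" for k
  proof (induction k)
    case (Suc k)
    then show ?case using \<mu>_Suc[of k] by (simp add: mult.assoc)
  qed simp
  moreover obtain k where "\<mu> 0 / c < \<rho> ^ k" using real_arch_pow[OF \<rho>] by blast
  ultimately have "\<rho> ^ k * \<mu> k < \<rho> ^ k * c" using assms by (metis pos_divide_less_eq)
  then have "\<mu> k \<le> c" using \<rho> by simp
  then show ?thesis by (rule that)
qed

lemma antimono_stair: "antimono_on {0<..} stair"
  unfolding stair_def
  by (intro monotone_onI SUP_mono) (auto simp: indicator_def intro!: exI)

lemma stair_ge: "s \<le> x k \<Longrightarrow> ennreal (\<mu> k) \<le> stair s"
  unfolding stair_def by (intro SUP_upper2[of k]) auto

lemma stair_le: "x k < s \<Longrightarrow> stair s \<le> ennreal (\<mu> (Suc k))"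
  unfolding stair_def
proof (rule SUP_least)
  fix j assume "x k < s"
  then have "Suc k \<le> j" if "s \<le> x j" using that x_mono[of j k] by (simp add: not_less_eq_eq[symmetric]) force
  then show "ennreal (\<mu> j) * indicator {..x j} s \<le> ennreal (\<mu> (Suc k))"
    by (auto simp: indicator_def intro!: ennreal_leI \<mu>_mono)
qed

lemma stair_cell:
  assumes "x k < s" "s \<le> x (Suc k)"
  shows "stair s = ennreal (\<mu> (Suc k))"
  using stair_le[OF assms(1)] stair_ge[OF assms(2)] by (rule antisym)

text \<open>The bounds \<open>lower\<close> add up over the intervals. Breakpoints suffice for the
  excess integrals, since \<open>stair\<close> crosses every positive level below
  \<open>\<mu> 0\<close> at one of them.\<close>

lemma nn_integral_stair_le: "(\<integral>\<^sup>+t\<in>{0<..x k}. stair t \<partial>halfline) \<le> (\<integral>\<^sup>+t\<in>{0<..x k}. f t \<partial>halfline)"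
proof (induction k)
  case (Suc k)
  have "(\<integral>\<^sup>+t\<in>{0<..x (Suc k)}. stair t \<partial>halfline)
      = (\<integral>\<^sup>+t\<in>{0<..x k}. stair t \<partial>halfline) + (\<integral>\<^sup>+t\<in>{x k<..x (Suc k)}. stair t \<partial>halfline)"
    by (intro nn_integral_Ioc_split antimono_M_plus antimono_stair x_nonneg x_Suc order_refl)
  also have "\<dots> \<le> (\<integral>\<^sup>+t\<in>{0<..x k}. f t \<partial>halfline) + (\<integral>\<^sup>+t\<in>{x k<..x (Suc k)}. f t \<partial>halfline)"
  proof (intro add_mono Suc)
    have "(\<integral>\<^sup>+t\<in>{x k<..x (Suc k)}. stair t \<partial>halfline)
        \<le> ennreal (\<mu> (Suc k)) * ennreal (x (Suc k) - x k)"
      by (intro nn_integral_Ioc_upper x_nonneg x_Suc stair_le)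
    also have "\<dots> = ennreal (\<mu> (Suc k) * (x (Suc k) - x k))"
      using x_Suc[of k] \<mu>_pos[of "Suc k"] by (simp add: ennreal_mult less_imp_le)
    finally show "(\<integral>\<^sup>+t\<in>{x k<..x (Suc k)}. stair t \<partial>halfline)
        \<le> (\<integral>\<^sup>+t\<in>{x k<..x (Suc k)}. f t \<partial>halfline)"
      using lower[of k] by (rule order_trans)
  qed
  also have "\<dots> = (\<integral>\<^sup>+t\<in>{0<..x (Suc k)}. f t \<partial>halfline)"
    by (intro nn_integral_Ioc_split[symmetric] f x_nonneg x_Suc order_refl)
  finally show ?case .
qed (simp add: x_0)

lemma nn_integral_excess_stair_le:
  assumes c: "0 < c"
  shows "(\<integral>\<^sup>+t. stair t - ennreal c \<partial>halfline) \<le> (\<integral>\<^sup>+t. f t - ennreal c \<partial>halfline)"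
proof -
  \<comment> \<open>For \<open>K = Suc J\<close> the level \<open>c\<close> lies between
    \<open>\<mu> (Suc J)\<close> and \<open>\<mu> J\<close>, so \<open>stair\<close> crosses it at
    \<open>x J\<close>; for \<open>K = 0\<close> it never exceeds \<open>c\<close>.\<close>
  define K where "K = (LEAST k. \<mu> k \<le> c)"
  have K: "\<mu> K \<le> c" using \<mu>_eventually_le[OF c] unfolding K_def by (metis LeastI)
  show ?thesis
  proof (cases K)
    case 0
    have "stair t - ennreal c = 0" if "0 < t" for t
    proof -
      have "stair t \<le> ennreal (\<mu> (Suc 0))" using that x_0 by (intro stair_le) simp
      also have "\<dots> \<le> ennreal c" using K 0 \<mu>_mono[of 0 "Suc 0"] by (intro ennreal_leI) simp
      finally show ?thesis using le_less_trans[OF _ ennreal_less_top] by (intro diff_eq_0_ennreal) blast+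
    qed
    then have "(\<integral>\<^sup>+t. stair t - ennreal c \<partial>halfline) = (\<integral>\<^sup>+t. 0 \<partial>halfline)"
      by (intro nn_integral_cong) auto
    then show ?thesis by simp
  next
    case (Suc J)
    have J: "c \<le> \<mu> J" using not_less_Least[of J "\<lambda>k. \<mu> k \<le> c"] Suc by (simp add: K_def)
    have "(\<integral>\<^sup>+t. stair t - ennreal c \<partial>halfline) + ennreal (c * x J)
        = (\<integral>\<^sup>+t\<in>{0<..x J}. stair t \<partial>halfline)"
    proof (rule nn_integral_Ioc_eq_excess)
      show "ennreal c \<le> stair t" if "0 < t" "t \<le> x J" for t
        using stair_ge[OF that(2)] ennreal_leI[OF J] by simp
      show "stair t \<le> ennreal c" if "x J < t" for t
        using stair_le[OF that] ennreal_leI[OF K] Suc by simp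
    qed (use c x_nonneg in \<open>auto intro!: antimono_M_plus antimono_stair\<close>)
    also have "\<dots> \<le> (\<integral>\<^sup>+t\<in>{0<..x J}. f t \<partial>halfline)" by (rule nn_integral_stair_le)
    also have "\<dots> \<le> (\<integral>\<^sup>+t. f t - ennreal c \<partial>halfline) + ennreal (c * x J)"
      using c x_nonneg by (intro nn_integral_Ioc_le_excess f) auto
    finally show ?thesis by (metis ennreal_add_left_cancel_le add.commute ennreal_neq_top infinity_ennreal_def)
  qed
qed

lemma norm_stair_le: "ri_banach_function_norm N \<Longrightarrow> N stair \<le> N f"
  by (rule ri_banach_function_norm.norm_le_of_excess_le)
    (auto intro: antimono_stair f nn_integral_excess_stair_le)

text \<open>By \<open>upper\<close> the averages of \<open>f\<close> over \<open>(x k, n]\<close>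
  are at most \<open>\<mu> k\<close>, which tends to 0, so no mass is left beyond all
  breakpoints.\<close>

lemma AE_eq_0_beyond: "AE t in halfline. (\<forall>k. x k < t) \<longrightarrow> f t = 0"
proof -
  have [measurable]: "f \<in> borel_measurable halfline" using f by (simp add: M_plus_def)
  define Z where "Z y = {t \<in> {0<..y}. \<forall>k. x k < t}" for y
  have "AE t in halfline. t \<in> Z (real n) \<longrightarrow> f t = 0" for n
  proof -
    have Z_eq: "Z (real n) = (\<Inter>k. {x k<..} \<inter> {0<..real n})" by (auto simp: Z_def)
    have Z: "Z (real n) \<in> sets halfline"
      unfolding Z_eq by (intro sets.countable_INT'' sets_halfline_borel) auto
    have small: "(\<integral>\<^sup>+t\<in>Z (real n). f t \<partial>halfline) \<le> ennreal e" if e: "0 < e" for e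
    proof -
      define c where "c = e / (real n + 1)"
      have "0 < c" using e by (simp add: c_def)
      then obtain k where k: "\<mu> k \<le> c" using \<mu>_eventually_le by blast
      show ?thesis
      proof (cases "x k \<le> real n")
        case True
        have "(\<integral>\<^sup>+t\<in>Z (real n). f t \<partial>halfline) \<le> (\<integral>\<^sup>+t\<in>{x k<..real n}. f t \<partial>halfline)"
          by (intro nn_integral_mono) (auto simp: indicator_def Z_def)
        also have "\<dots> \<le> ennreal (\<mu> k * (real n - x k))" by (rule upper[OF True])
        also have "\<dots> \<le> ennreal (c * (real n + 1))"
          using k True x_nonneg[of k] \<mu>_pos[of k] by (intro ennreal_leI mult_mono) auto
        finally show ?thesis by (simp add: c_def)
      next
        case False
        have "Z (real n) = {}"
        proof (rule equals0I)
          fix t assume "t \<in> Z (real n)"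
          then have "x k < t" "t \<le> real n" by (auto simp: Z_def)
          with False show False by simp
        qed
        then show ?thesis by simp
      qed
    qed
    have "(\<integral>\<^sup>+t\<in>Z (real n). f t \<partial>halfline) \<le> 0"
    proof (rule ennreal_le_epsilon)
      fix e :: real assume "0 < e"
      from small[OF this] show "(\<integral>\<^sup>+t\<in>Z (real n). f t \<partial>halfline) \<le> 0 + ennreal e" by simp
    qed
    then have "(\<integral>\<^sup>+t\<in>Z (real n). f t \<partial>halfline) = 0" by simp
    moreover have "(\<lambda>t. f t * indicator (Z (real n)) t) \<in> borel_measurable halfline"
      using Z by (intro borel_measurable_times_ennreal borel_measurable_indicator) auto
    ultimately have "AE t in halfline. f t * indicator (Z (real n)) t = 0"
      by (simp only: nn_integral_0_iff_AE)
    then show ?thesis by eventually_elim (auto simp: indicator_def split: if_splits)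
  qed
  then have "AE t in halfline. \<forall>n. t \<in> Z (real n) \<longrightarrow> f t = 0"
    by (subst AE_all_countable) blast
  moreover have "AE t in halfline. t \<in> {0<..}" by (rule AE_I2) simp
  ultimately show ?thesis
  proof eventually_elim
    case (elim t)
    obtain n where "t \<le> real n" using real_arch_simple by blast
    with elim show ?case by (auto simp: Z_def)
  qed
qed

text \<open>On \<open>(x k, x (Suc k)]\<close> the averages of \<open>f\<close> from the left end
  are at most \<open>\<mu> k\<close>, that is \<open>\<rho>\<close> times the value of
  \<open>stair\<close>; the doubling estimate contributes \<open>2 * c\<close>.\<close>

lemma nn_integral_le_stair:
  assumes h: "h \<in> M_plus" and c: "0 \<le> c"
    and doubling: "\<And>s r. 0 < s \<Longrightarrow> s \<le> r \<Longrightarrow> r \<le> 2 * s \<Longrightarrow> h r \<le> ennreal c * h s"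
  shows "(\<integral>\<^sup>+t. f t * h t \<partial>halfline) \<le> ennreal (2 * \<rho> * c) * (\<integral>\<^sup>+t. stair t * h t \<partial>halfline)"
proof -
  have [measurable]: "f \<in> borel_measurable halfline" "h \<in> borel_measurable halfline"
    "stair \<in> borel_measurable halfline"
    using f h antimono_M_plus[OF antimono_stair] by (auto simp: M_plus_def)
  have fh: "(\<lambda>t. f t * h t) \<in> M_plus" and sh: "(\<lambda>t. stair t * h t) \<in> M_plus"
    by (auto simp: M_plus_def)
  have part: "(\<integral>\<^sup>+t\<in>{0<..x k}. f t * h t \<partial>halfline)
      \<le> ennreal (2 * \<rho> * c) * (\<integral>\<^sup>+t\<in>{0<..x k}. stair t * h t \<partial>halfline)" for k
  proof (induction k)
    case (Suc k)
    have split: "(\<integral>\<^sup>+t\<in>{0<..x (Suc k)}. g t \<partial>halfline)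
      = (\<integral>\<^sup>+t\<in>{0<..x k}. g t \<partial>halfline) + (\<integral>\<^sup>+t\<in>{x k<..x (Suc k)}. g t \<partial>halfline)"
      if "g \<in> M_plus" for g
      by (intro nn_integral_Ioc_split that x_nonneg x_Suc order_refl)
    have [measurable]: "{x k<..x (Suc k)} \<in> sets halfline"
      using x_nonneg[of k] by (auto intro!: sets_halfline_borel)
    have "(\<integral>\<^sup>+t\<in>{x k<..x (Suc k)}. f t * h t \<partial>halfline)
        \<le> ennreal (2 * \<mu> k * c) * (\<integral>\<^sup>+t\<in>{x k<..x (Suc k)}. h t \<partial>halfline)"
      using \<mu>_pos[of k]
      by (intro nn_integral_Ioc_doubling_le f h c doubling x_nonneg x_Suc upper) auto
    also have "\<dots> = ennreal (2 * \<rho> * c)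
        * (ennreal (\<mu> (Suc k)) * (\<integral>\<^sup>+t\<in>{x k<..x (Suc k)}. h t \<partial>halfline))"
      using \<mu>_pos[of "Suc k"] \<rho> c
      by (simp add: \<mu>_Suc[of k] mult.assoc[symmetric] ennreal_mult[symmetric]) (simp add: ac_simps)
    also have "ennreal (\<mu> (Suc k)) * (\<integral>\<^sup>+t\<in>{x k<..x (Suc k)}. h t \<partial>halfline)
        = (\<integral>\<^sup>+t\<in>{x k<..x (Suc k)}. stair t * h t \<partial>halfline)"
    proof -
      have "ennreal (\<mu> (Suc k)) * (\<integral>\<^sup>+t\<in>{x k<..x (Suc k)}. h t \<partial>halfline)
          = (\<integral>\<^sup>+t. ennreal (\<mu> (Suc k)) * (h t * indicator {x k<..x (Suc k)} t) \<partial>halfline)"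
        by (rule nn_integral_cmult[symmetric]) measurable
      also have "\<dots> = (\<integral>\<^sup>+t\<in>{x k<..x (Suc k)}. stair t * h t \<partial>halfline)"
        by (intro nn_integral_cong) (auto simp: indicator_def stair_cell)
      finally show ?thesis .
    qed
    finally show ?case
      unfolding split[OF fh] split[OF sh] distrib_left by (intro add_mono Suc)
  qed (simp add: x_0)
  define A where "A k = {0<..x k}" for k
  have A: "range A \<subseteq> sets halfline" "incseq A"
    by (auto simp: A_def incseq_def intro!: sets_halfline_borel intro: order_trans[OF _ x_mono])
  then have UA: "(\<Union>k. A k) \<in> sets halfline" by auto
  have "(\<integral>\<^sup>+t. f t * h t \<partial>halfline) = (\<integral>\<^sup>+t\<in>(\<Union>k. A k). f t * h t \<partial>halfline)"
  proof (rule nn_integral_cong_AE)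
    have "AE t in halfline. t \<in> {0<..}" by (rule AE_I2) simp
    with AE_eq_0_beyond show "AE t in halfline. f t * h t = f t * h t * indicator (\<Union>k. A k) t"
      by eventually_elim (auto simp: A_def indicator_def not_le)
  qed
  also have "\<dots> = emeasure (density halfline (\<lambda>t. f t * h t)) (\<Union>k. A k)"
    using UA by (subst emeasure_density) auto
  also have "\<dots> = (SUP k. emeasure (density halfline (\<lambda>t. f t * h t)) (A k))"
    using A by (intro SUP_emeasure_incseq[symmetric]) auto
  also have "\<dots> \<le> ennreal (2 * \<rho> * c) * (\<integral>\<^sup>+t. stair t * h t \<partial>halfline)"
  proof (rule SUP_least)
    fix k
    have "emeasure (density halfline (\<lambda>t. f t * h t)) (A k) = (\<integral>\<^sup>+t\<in>{0<..x k}. f t * h t \<partial>halfline)"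
      using A by (subst emeasure_density) (auto simp: A_def)
    also note part[of k]
    also have "ennreal (2 * \<rho> * c) * (\<integral>\<^sup>+t\<in>{0<..x k}. stair t * h t \<partial>halfline)
        \<le> ennreal (2 * \<rho> * c) * (\<integral>\<^sup>+t. stair t * h t \<partial>halfline)"
      by (intro mult_left_mono nn_integral_mono) (auto simp: indicator_def)
    finally show "emeasure (density halfline (\<lambda>t. f t * h t)) (A k)
        \<le> ennreal (2 * \<rho> * c) * (\<integral>\<^sup>+t. stair t * h t \<partial>halfline)" .
  qed
  finally show ?thesis .
qed

end

text \<open>Boundedness makes \<open>F\<close> Lipschitz and bounded support confines the search to
  \<open>[0, L]\<close>, so \<open>F y - m * y\<close> attains its maximum over
  \<open>y \<ge> 0\<close> for every \<open>m \<ge> 0\<close>.\<close>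

lemma staircase_exists:
  assumes f: "f \<in> M_plus" and \<rho>: "1 < \<rho>" and B: "0 < B" "\<And>t. f t \<le> ennreal B"
    and supp: "\<And>t. L < t \<Longrightarrow> f t = 0" and L: "0 \<le> L"
  shows "\<exists>x \<mu>. staircase f x \<mu> \<rho>"
proof -
  define F where "F y = enn2real (\<integral>\<^sup>+t\<in>{0<..y}. f t \<partial>halfline)" for y
  have int_le: "(\<integral>\<^sup>+t\<in>{a<..b}. f t \<partial>halfline) \<le> ennreal (B * (b - a))" if "0 \<le> a" "a \<le> b" for a b
    using nn_integral_Ioc_upper[OF that, of f "ennreal B"] B that by (simp add: ennreal_mult)
  have int_F: "(\<integral>\<^sup>+t\<in>{a<..b}. f t \<partial>halfline) = ennreal (F b - F a)" "F a \<le> F b"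
    if "0 \<le> a" "a \<le> b" for a b
  proof -
    define I where "I = (\<integral>\<^sup>+t\<in>{a<..b}. f t \<partial>halfline)"
    have "(\<integral>\<^sup>+t\<in>{0<..b}. f t \<partial>halfline) = (\<integral>\<^sup>+t\<in>{0<..a}. f t \<partial>halfline) + I"
      unfolding I_def using that by (intro nn_integral_Ioc_split f) auto
    moreover have "(\<integral>\<^sup>+t\<in>{0<..a}. f t \<partial>halfline) < top" "I < top"
      using int_le[of 0 a] int_le[OF that] that unfolding I_def
      by (auto intro: le_less_trans)
    ultimately have "F b = F a + enn2real I" "I = ennreal (enn2real I)"
      unfolding F_def by (auto simp: enn2real_plus)
    then show "(\<integral>\<^sup>+t\<in>{a<..b}. f t \<partial>halfline) = ennreal (F b - F a)" "F a \<le> F b"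
      unfolding I_def[symmetric] by (auto simp: enn2real_nonneg)
  qed
  have F_lip: "F b - F a \<le> B * (b - a)" if "0 \<le> a" "a \<le> b" for a b
    using int_le[OF that] int_F[OF that] B that by (simp add: ennreal_le_iff)
  have F_const: "F y = F L" if "L \<le> y" for y
  proof -
    have "(\<integral>\<^sup>+t\<in>{L<..y}. f t \<partial>halfline) = (\<integral>\<^sup>+t. 0 \<partial>halfline)"
      using supp by (intro nn_integral_cong) (auto simp: indicator_def)
    then show ?thesis using int_F[OF L that] by simp
  qed
  have "continuous_on {0..L} F"
  proof (rule lipschitz_on_continuous_on[OF lipschitz_onI])
    show "dist (F y) (F z) \<le> B * dist y z" if "y \<in> {0..L}" "z \<in> {0..L}" for y z
      using that F_lip[of y z] F_lip[of z y] int_F(2)[of y z] int_F(2)[of z y]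
      by (cases "y \<le> z") (auto simp: dist_real_def)
  qed (use B in simp)
  then have "\<exists>z\<in>{0..L}. \<forall>y\<in>{0..L}. F y - m * y \<le> F z - m * z" for m
    using L by (intro continuous_attains_sup continuous_intros) auto
  then obtain X where X: "\<And>m. X m \<in> {0..L}" "\<And>m y. y \<in> {0..L} \<Longrightarrow> F y - m * y \<le> F (X m) - m * X m"
    by metis
  have X_max: "F y - m * y \<le> F (X m) - m * X m" if "0 \<le> m" "0 \<le> y" for m y
  proof (cases "y \<le> L")
    case False
    then have "m * L \<le> m * y" using that by (intro mult_left_mono) auto
    then show ?thesis using X(2)[of L m] F_const[of y] False L by simp
  qed (use X(2) that in auto)
  \<comment> \<open>The maximisers are chosen arbitrarily, yet adding the two maximality
    inequalities orders them for distinct slopes.\<close>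
  have X_mono: "X m' \<le> X m" if "0 \<le> m" "m < m'" for m m'
  proof -
    have "F (X m') - m * X m' \<le> F (X m) - m * X m" "F (X m) - m' * X m \<le> F (X m') - m' * X m'"
      using X(1)[of m] X(1)[of m'] that by (auto intro!: X_max)
    then have "(m' - m) * X m' \<le> (m' - m) * X m" by (simp add: algebra_simps)
    then show ?thesis using that by simp
  qed
  \<comment> \<open>\<open>F\<close> grows at rate at most \<open>B\<close>, so the starting slope
    \<open>2 * B\<close>, being strictly larger, forces the maximiser 0.\<close>
  define \<mu> where "\<mu> k = 2 * B / \<rho> ^ k" for k
  have \<mu>: "0 < \<mu> k" "\<mu> k = \<rho> * \<mu> (Suc k)" "\<mu> (Suc k) < \<mu> k" for k
    using B \<rho> by (auto simp: \<mu>_def field_simps)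
  have "staircase f (\<lambda>k. X (\<mu> k)) \<mu> \<rho>"
  proof
    show "X (\<mu> 0) = 0"
    proof -
      have "F 0 \<le> F (X (\<mu> 0)) - \<mu> 0 * X (\<mu> 0)" using X_max[of "\<mu> 0" 0] \<mu>(1)[of 0] by simp
      moreover have "F (X (\<mu> 0)) - F 0 \<le> B * X (\<mu> 0)"
        using X(1)[of "\<mu> 0"] F_lip[of 0 "X (\<mu> 0)"] by simp
      moreover have "\<mu> 0 * X (\<mu> 0) = B * X (\<mu> 0) + B * X (\<mu> 0)" by (simp add: \<mu>_def)
      ultimately have "B * X (\<mu> 0) \<le> 0" by linarith
      then have "X (\<mu> 0) \<le> 0" using B(1) by (simp add: mult_le_0_iff)
      then show ?thesis using X(1)[of "\<mu> 0"] by simp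
    qed
    show "X (\<mu> k) \<le> X (\<mu> (Suc k))" for k using X_mono[of "\<mu> (Suc k)" "\<mu> k"] \<mu>(1)[of "Suc k"] \<mu>(3)[of k] by simp
    \<comment> \<open>Maximality of \<open>X (\<mu> k)\<close> against the competitor
      \<open>y\<close>. The lower bound after it is maximality of \<open>X (\<mu> (Suc k))\<close>
      against \<open>X (\<mu> k)\<close>.\<close>
    show "(\<integral>\<^sup>+t\<in>{X (\<mu> k)<..y}. f t \<partial>halfline) \<le> ennreal (\<mu> k * (y - X (\<mu> k)))"
      if "X (\<mu> k) \<le> y" for k y
      using that X(1)[of "\<mu> k"] X_max[of "\<mu> k" y] \<mu>(1)[of k]
      by (subst int_F) (auto intro!: ennreal_leI simp: algebra_simps)
    show "ennreal (\<mu> (Suc k) * (X (\<mu> (Suc k)) - X (\<mu> k)))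
        \<le> (\<integral>\<^sup>+t\<in>{X (\<mu> k)<..X (\<mu> (Suc k))}. f t \<partial>halfline)" for k
      using X(1)[of "\<mu> k"] X_max[of "\<mu> (Suc k)" "X (\<mu> k)"] \<mu>(1)[of "Suc k"] X_mono[of "\<mu> (Suc k)" "\<mu> k"] \<mu>(3)[of k]
      by (subst int_F) (auto intro!: ennreal_leI simp: algebra_simps)
  qed (fact f \<rho> \<mu>(1) \<mu>(2))+
  then show ?thesis by blast
qed

subsection \<open>The Hardy-type operator\<close>

lemma nn_integral_halfline_scale:
  assumes "g \<in> M_plus"
  shows "(\<integral>\<^sup>+t. g t \<partial>halfline) = 2 * (\<integral>\<^sup>+t. g (2 * t) \<partial>halfline)"
proof -
  have "g \<in> borel_measurable halfline" using assms by (simp add: M_plus_def)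
  then have "(\<lambda>t. g t * indicator {0<..} t) \<in> borel_measurable lebesgue"
    by (subst (asm) borel_measurable_restrict_space_iff_ennreal) (auto simp: mult.commute)
  from nn_integral_real_affine_lebesgue[OF this, of 2 0]
  show ?thesis by (simp add: nn_integral_restrict_space indicator_def zero_less_mult_iff)
qed

locale hardy_kernel =
  fixes I :: "real \<Rightarrow> real" and m :: nat
  assumes m: "1 \<le> m" and I_pos: "\<And>t. 0 < t \<Longrightarrow> 0 < I t" and I_mono: "mono_on {0<..} I"
begin

text \<open>The inner integral as an \<open>ennreal\<close>, defined for all arguments without
  integrability conditions and jointly measurable, as Tonelli requires.\<close>

definition \<kappa> :: "real \<Rightarrow> real \<Rightarrow> ennreal" where
  "\<kappa> t s = (\<integral>\<^sup>+r. indicator {t<..<s} r * ennreal (1 / I r) \<partial>halfline)"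

lemma inverse_I_antimono: "0 < s \<Longrightarrow> s \<le> r \<Longrightarrow> ennreal (1 / I r) \<le> ennreal (1 / I s)"
  using I_pos[of s] I_pos[of r] mono_onD[OF I_mono, of s r]
  by (intro ennreal_leI divide_left_mono) auto

lemma inverse_I_M_plus: "(\<lambda>r. ennreal (1 / I r)) \<in> M_plus"
  by (intro antimono_M_plus monotone_onI) (auto intro: inverse_I_antimono)

lemma measurable_inverse_I [measurable]: "(\<lambda>r. ennreal (1 / I r)) \<in> borel_measurable halfline"
  using inverse_I_M_plus by (simp add: M_plus_def)

lemma measurable_ident_halfline [measurable]: "(\<lambda>x. x) \<in> halfline \<rightarrow>\<^sub>M borel"
  by (rule borel_imp_measurable_halfline) simp

lemma measurable_\<kappa> [measurable]:
  "(\<lambda>p. \<kappa> (fst p) (snd p)) \<in> borel_measurable (halfline \<Otimes>\<^sub>M halfline)"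
proof -
  interpret sigma_finite_measure halfline by (rule sigma_finite_halfline)
  show ?thesis
    unfolding \<kappa>_def greaterThanLessThan_iff indicator_def of_bool_def
    by measurable
qed

text \<open>On \<open>(t, s)\<close> the integrand is bounded by \<open>1 / I t\<close>, so it is
  integrable and the Bochner integral is not the default value 0.\<close>

lemma \<kappa>_eq:
  assumes t: "0 < t" "t < s"
  shows "ennreal (LBINT r=t..s. 1 / I r) = \<kappa> t s"
proof -
  let ?g = "\<lambda>r. indicator {t<..<s} r * (1 / I r)"
  have "I \<in> borel_measurable (restrict_space borel {0<..})"
    by (rule borel_measurable_mono_on_fnc[OF I_mono])
  then have "I \<in> borel_measurable (restrict_space borel {t<..<s})"
    by (rule measurable_restrict_mono) (use t in auto)
  then have "(\<lambda>r. 1 / I r) \<in> borel_measurable (restrict_space borel {t<..<s})" by measurable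
  then have meas: "?g \<in> borel_measurable lborel"
    by (subst (asm) borel_measurable_restrict_space_iff) auto
  have bound: "0 \<le> ?g r" "?g r \<le> indicator {t<..<s} r * (1 / I t)" for r
    using t I_pos[of t] I_pos[of r] mono_onD[OF I_mono, of t r]
    by (auto simp: indicator_def intro!: divide_left_mono)
  have int: "integrable lborel ?g"
  proof (rule Bochner_Integration.integrable_bound[OF _ meas])
    show "integrable lborel (\<lambda>r. indicator {t<..<s} r * (1 / I t))"
      by (intro integrable_mult_left integrable_real_indicator) (use t in auto)
    show "AE r in lborel. norm (?g r) \<le> norm (indicator {t<..<s} r * (1 / I t))"
    proof (rule AE_I2)
      fix r
      have "norm (?g r) = ?g r" using bound(1)[of r] by (simp only: real_norm_def abs_of_nonneg)
      also note bound(2)[of r]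
      also have "indicator {t<..<s} r * (1 / I t) \<le> norm (indicator {t<..<s} r * (1 / I t))"
        unfolding real_norm_def by (rule abs_ge_self)
      finally show "norm (?g r) \<le> norm (indicator {t<..<s} r * (1 / I t))" .
    qed
  qed
  have "ennreal (LBINT r=t..s. 1 / I r) = ennreal (integral\<^sup>L lborel ?g)"
    using t by (simp add: interval_lebesgue_integral_def set_lebesgue_integral_def)
  also have "\<dots> = (\<integral>\<^sup>+r. ennreal (?g r) \<partial>lborel)"
    using int bound by (intro nn_integral_eq_integral[symmetric] AE_I2)
  also have "\<dots> = (\<integral>\<^sup>+r. ennreal (?g r) \<partial>lebesgue)" by (rule nn_integral_completion[symmetric])
  also have "\<dots> = \<kappa> t s"
    unfolding \<kappa>_def using t
    by (subst nn_integral_restrict_space) (auto intro!: nn_integral_cong simp: indicator_def)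
  finally show ?thesis .
qed

lemma \<kappa>_antimono: "t \<le> t' \<Longrightarrow> \<kappa> t' s \<le> \<kappa> t s"
  unfolding \<kappa>_def by (intro nn_integral_mono) (auto simp: indicator_def)

text \<open>The substitution \<open>q \<mapsto> 2 q\<close> turns \<open>(2 u, r)\<close> into
  \<open>(u, r / 2)\<close>, which lies in \<open>(u, s)\<close>, and \<open>1 / I (2 q)\<close> is
  at most \<open>1 / I q\<close>.\<close>

lemma \<kappa>_double:
  assumes "0 < u" "r \<le> 2 * s"
  shows "\<kappa> (2 * u) r \<le> 2 * \<kappa> u s"
proof -
  have "(\<lambda>q. indicator {2 * u<..<r} q * ennreal (1 / I q)) \<in> M_plus"
    using inverse_I_M_plus unfolding M_plus_def
    by (intro borel_measurable_times_ennreal borel_measurable_indicator)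
      (use assms in \<open>auto intro!: sets_halfline_borel\<close>)
  then have "\<kappa> (2 * u) r = 2 * (\<integral>\<^sup>+q. indicator {2 * u<..<r} (2 * q) * ennreal (1 / I (2 * q)) \<partial>halfline)"
    unfolding \<kappa>_def by (rule nn_integral_halfline_scale)
  also have "\<dots> \<le> 2 * \<kappa> u s"
    unfolding \<kappa>_def
  proof (intro mult_left_mono nn_integral_mono)
    fix q assume "q \<in> space halfline"
    then show "indicator {2 * u<..<r} (2 * q) * ennreal (1 / I (2 * q))
        \<le> indicator {u<..<s} q * ennreal (1 / I q)"
      using assms inverse_I_antimono[of q "2 * q"] by (auto simp: indicator_def)
  qed simp
  finally show ?thesis .
qed

lemma H_op_eq:
  assumes t: "0 < t"
  shows "H_op I m f t
    = (\<integral>\<^sup>+s. f s * (indicator {t<..} s * ennreal (1 / I s) * \<kappa> t s ^ (m - 1)) \<partial>halfline)"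
  unfolding H_op_def
proof (rule nn_integral_cong)
  fix s assume "s \<in> space halfline"
  then have s: "0 < s" by simp
  show "f s / ennreal (I s) * ennreal ((LBINT r=t..s. 1 / I r) ^ (m - 1)) * indicator {t<..} s
      = f s * (indicator {t<..} s * ennreal (1 / I s) * \<kappa> t s ^ (m - 1))"
  proof (cases "t < s")
    case True
    have nonneg: "0 \<le> (LBINT r=t..s. 1 / I r)"
      using True t I_pos
      by (auto simp: interval_lebesgue_integral_def set_lebesgue_integral_def indicator_def less_imp_le
          intro!: integral_nonneg_AE AE_I2)
    have "f s / ennreal (I s) = f s * ennreal (1 / I s)"
      using I_pos[OF s] by (simp add: divide_ennreal_def inverse_ennreal inverse_eq_divide)
    moreover have "ennreal ((LBINT r=t..s. 1 / I r) ^ (m - 1)) = \<kappa> t s ^ (m - 1)"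
      using nonneg by (simp add: ennreal_power[symmetric] \<kappa>_eq[OF t True])
    ultimately show ?thesis using True by (simp add: ac_simps)
  qed simp
qed

text \<open>Raising \<open>t\<close> shrinks both the domain and \<open>\<kappa> t s\<close>,
  whatever \<open>f\<close> is. Hence \<open>hardy_littlewood_polya\<close> applies in the target
  space without any rearrangement there.\<close>

lemma antimono_H_op: "antimono_on {0<..} (H_op I m f)"
proof (rule monotone_onI)
  fix t t' :: real assume "t \<in> {0<..}" "t' \<in> {0<..}" "t \<le> t'"
  then show "H_op I m f t' \<le> H_op I m f t"
    by (auto simp: H_op_eq indicator_def intro!: nn_integral_mono mult_left_mono power_mono \<kappa>_antimono)
qed

text \<open>The function \<open>w\<close> of the overview. The condition \<open>t < s\<close> is an
  indicator so that the kernel is a single function on the product space.\<close>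

definition weight :: "real \<Rightarrow> real \<Rightarrow> ennreal" where
  "weight a s = ennreal (1 / I s)
    * (\<integral>\<^sup>+t. indicator {0<..a} t * indicator {t<..} s * \<kappa> t s ^ (m - 1) \<partial>halfline)"

lemma measurable_kernel [measurable]:
  "(\<lambda>p. indicator {0<..a} (fst p) * indicator {fst p<..} (snd p) * \<kappa> (fst p) (snd p) ^ (m - 1))
    \<in> borel_measurable (halfline \<Otimes>\<^sub>M halfline)"
  unfolding greaterThan_iff greaterThanAtMost_iff indicator_def of_bool_def by measurable

lemma weight_M_plus: "weight a \<in> M_plus"
proof -
  interpret sigma_finite_measure halfline by (rule sigma_finite_halfline)
  have "(\<lambda>p. indicator {0<..a} (snd p) * indicator {snd p<..} (fst p) * \<kappa> (snd p) (fst p) ^ (m - 1))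
    \<in> borel_measurable (halfline \<Otimes>\<^sub>M halfline)"
    using measurable_compose[OF measurable_pair_swap' measurable_kernel[of a]]
    by (simp add: case_prod_beta)
  then have "(\<lambda>s. \<integral>\<^sup>+t. indicator {0<..a} t * indicator {t<..} s * \<kappa> t s ^ (m - 1) \<partial>halfline)
     \<in> borel_measurable halfline"
    by (intro borel_measurable_nn_integral) (simp add: case_prod_beta)
  then show ?thesis
    unfolding M_plus_def weight_def[abs_def] by measurable
qed

lemma measurable_kernel1:
  "0 < s \<Longrightarrow> (\<lambda>t. indicator {0<..a} t * indicator {t<..} s * \<kappa> t s ^ (m - 1)) \<in> borel_measurable halfline"
  using measurable_compose[OF measurable_Pair2'[of s halfline halfline] measurable_kernel[of a]] by simp

lemma measurable_kernel2:
  assumes "0 < t"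
  shows "(\<lambda>s. indicator {t<..} s * ennreal (1 / I s) * \<kappa> t s ^ (m - 1)) \<in> borel_measurable halfline"
proof -
  have [measurable]: "(\<lambda>s. indicator {0<..t} t * indicator {t<..} s * \<kappa> t s ^ (m - 1)) \<in> borel_measurable halfline"
    using measurable_compose[OF measurable_Pair1'[of t halfline halfline] measurable_kernel[of t]] assms by simp
  have "(\<lambda>s. ennreal (1 / I s) * (indicator {0<..t} t * indicator {t<..} s * \<kappa> t s ^ (m - 1)))
      \<in> borel_measurable halfline" by measurable
  then show ?thesis using assms by (simp add: ac_simps)
qed

lemma nn_integral_H_op:
  assumes f: "f \<in> M_plus"
  shows "(\<integral>\<^sup>+t\<in>{0<..a}. H_op I m f t \<partial>halfline) = (\<integral>\<^sup>+s. f s * weight a s \<partial>halfline)"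
proof -
  interpret sigma_finite_measure halfline by (rule sigma_finite_halfline)
  interpret pair_sigma_finite halfline halfline ..
  have [measurable]: "f \<in> borel_measurable halfline" using f by (simp add: M_plus_def)
  let ?k = "\<lambda>t s. indicator {0<..a} t * indicator {t<..} s * \<kappa> t s ^ (m - 1)"
  have "(\<integral>\<^sup>+t\<in>{0<..a}. H_op I m f t \<partial>halfline)
      = (\<integral>\<^sup>+t. \<integral>\<^sup>+s. f s * ennreal (1 / I s) * ?k t s \<partial>halfline \<partial>halfline)"
  proof (rule nn_integral_cong)
    fix t assume "t \<in> space halfline"
    then show "H_op I m f t * indicator {0<..a} t = (\<integral>\<^sup>+s. f s * ennreal (1 / I s) * ?k t s \<partial>halfline)"
      by (auto simp: H_op_eq indicator_def ac_simps)
  qed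
  also have "\<dots> = (\<integral>\<^sup>+s. \<integral>\<^sup>+t. f s * ennreal (1 / I s) * ?k t s \<partial>halfline \<partial>halfline)"
  proof (rule Fubini'[symmetric])
    show "(\<lambda>(t, s). f s * ennreal (1 / I s) * ?k t s) \<in> borel_measurable (halfline \<Otimes>\<^sub>M halfline)"
      unfolding case_prod_beta by measurable
  qed
  also have "\<dots> = (\<integral>\<^sup>+s. f s * weight a s \<partial>halfline)"
  proof (rule nn_integral_cong)
    fix s assume "s \<in> space halfline"
    then have "(\<integral>\<^sup>+t. f s * ennreal (1 / I s) * ?k t s \<partial>halfline)
        = f s * ennreal (1 / I s) * (\<integral>\<^sup>+t. ?k t s \<partial>halfline)"
      by (intro nn_integral_cmult measurable_kernel1) simp
    then show "(\<integral>\<^sup>+t. f s * ennreal (1 / I s) * ?k t s \<partial>halfline) = f s * weight a s"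
      by (simp add: weight_def mult.assoc)
  qed
  finally show ?thesis .
qed

text \<open>The substitution \<open>t \<mapsto> 2 t\<close> gives a factor \<open>2\<close>,
  \<open>\<kappa>_double\<close> gives \<open>2 ^ (m - 1)\<close>, and \<open>1 / I r\<close> is at
  most \<open>1 / I s\<close>.\<close>

lemma weight_doubling:
  assumes s: "0 < s" "s \<le> r" "r \<le> 2 * s"
  shows "weight a r \<le> ennreal (2 ^ m) * weight a s"
proof -
  let ?k = "\<lambda>t s. indicator {0<..a} t * indicator {t<..} s * \<kappa> t s ^ (m - 1)"
  have r: "0 < r" using s by simp
  have "(\<integral>\<^sup>+t. ?k t r \<partial>halfline) = 2 * (\<integral>\<^sup>+t. ?k (2 * t) r \<partial>halfline)"
    using measurable_kernel1[OF r, of a] by (intro nn_integral_halfline_scale) (simp add: M_plus_def)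
  also have "\<dots> \<le> 2 * (\<integral>\<^sup>+t. 2 ^ (m - 1) * ?k t s \<partial>halfline)"
  proof (intro mult_left_mono nn_integral_mono)
    fix t assume "t \<in> space halfline"
    then have t: "0 < t" by simp
    have "\<kappa> (2 * t) r ^ (m - 1) \<le> (2 * \<kappa> t s) ^ (m - 1)"
      by (intro power_mono \<kappa>_double t s) simp
    then show "?k (2 * t) r \<le> 2 ^ (m - 1) * ?k t s"
      using t s by (auto simp: indicator_def power_mult_distrib)
  qed simp
  also have "\<dots> = 2 * (2 ^ (m - 1) * (\<integral>\<^sup>+t. ?k t s \<partial>halfline))"
    by (simp only: nn_integral_cmult[OF measurable_kernel1[OF s(1)]])
  also have "\<dots> = ennreal (2 ^ m) * (\<integral>\<^sup>+t. ?k t s \<partial>halfline)"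
  proof -
    have "(2::ennreal) * 2 ^ (m - 1) = 2 ^ m" using m by (cases m) auto
    then show ?thesis by (simp add: mult.assoc[symmetric] ennreal_power[symmetric])
  qed
  finally have "weight a r \<le> ennreal (1 / I s) * (ennreal (2 ^ m) * (\<integral>\<^sup>+t. ?k t s \<partial>halfline))"
    unfolding weight_def by (intro mult_mono inverse_I_antimono s) auto
  then show ?thesis by (simp add: weight_def ac_simps)
qed

lemma norm_H_op_le_stair:
  assumes X: "ri_banach_function_norm X" and Y: "ri_banach_function_norm Y" and D: "0 \<le> D"
    and bound: "\<And>g. g \<in> bfs_nonneg X \<Longrightarrow> antimono_on {0<..} g \<Longrightarrow> Y (H_op I m g) \<le> ennreal D * X g"
    and stair: "staircase f x \<mu> \<rho>" and fin: "X f < \<infinity>"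
  shows "Y (H_op I m f) \<le> ennreal (2 ^ (m + 1) * D * \<rho>) * X f"
proof -
  interpret X: ri_banach_function_norm X by fact
  interpret Y: ri_banach_function_norm Y by fact
  interpret staircase f x \<mu> \<rho> by fact
  have stair_le: "X stair \<le> X f" by (rule norm_stair_le[OF X])
  have stair_M: "stair \<in> M_plus" by (intro antimono_M_plus antimono_stair)
  have H_M: "H_op I m stair \<in> M_plus" by (intro antimono_M_plus antimono_H_op)
  then have [measurable]: "H_op I m stair \<in> borel_measurable halfline" by (simp add: M_plus_def)
  \<comment> \<open>\<open>2 * \<rho>\<close> comes from comparing \<open>f\<close> with
    \<open>stair\<close>, and \<open>2 ^ m\<close> from the doubling of the weight.\<close>
  define c where "c = 2 * \<rho> * 2 ^ m"
  have c: "0 \<le> c" using \<rho> by (simp add: c_def)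
  have "Y (H_op I m f) \<le> Y (\<lambda>t. ennreal c * H_op I m stair t)"
  proof (rule Y.hardy_littlewood_polya[OF antimono_H_op])
    show "antimono_on {0<..} (\<lambda>t. ennreal c * H_op I m stair t)"
      using antimono_on_halflineD[OF antimono_H_op] by (intro monotone_onI mult_left_mono) auto
    fix a :: real assume "0 < a"
    then have [measurable]: "{0<..a} \<in> sets halfline" by (intro sets_halfline_borel) auto
    have "(\<integral>\<^sup>+t\<in>{0<..a}. H_op I m f t \<partial>halfline) = (\<integral>\<^sup>+s. f s * weight a s \<partial>halfline)"
      by (rule nn_integral_H_op[OF f])
    also have "\<dots> \<le> ennreal c * (\<integral>\<^sup>+s. stair s * weight a s \<partial>halfline)"
      unfolding c_def by (intro nn_integral_le_stair weight_M_plus weight_doubling) auto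
    also have "\<dots> = ennreal c * (\<integral>\<^sup>+t\<in>{0<..a}. H_op I m stair t \<partial>halfline)"
      by (simp add: nn_integral_H_op[OF stair_M])
    also have "\<dots> = (\<integral>\<^sup>+t\<in>{0<..a}. ennreal c * H_op I m stair t \<partial>halfline)"
      by (subst nn_integral_cmult[symmetric]) (auto simp: mult.assoc)
    finally show "(\<integral>\<^sup>+t\<in>{0<..a}. H_op I m f t \<partial>halfline)
        \<le> (\<integral>\<^sup>+t\<in>{0<..a}. ennreal c * H_op I m stair t \<partial>halfline)" .
  qed
  also have "\<dots> = ennreal c * Y (H_op I m stair)" using c by (intro Y.P1_homogeneous H_M)
  also have "\<dots> \<le> ennreal c * (ennreal D * X stair)"
    using stair_M stair_le fin antimono_stair
    by (intro mult_left_mono bound) (auto simp: bfs_nonneg_def)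
  also have "\<dots> \<le> ennreal c * (ennreal D * X f)" by (intro mult_left_mono stair_le) auto
  also have "\<dots> = ennreal (2 ^ (m + 1) * D * \<rho>) * X f"
    using c D by (simp add: mult.assoc[symmetric] ennreal_mult[symmetric] c_def) (simp add: ac_simps)
  finally show ?thesis .
qed

lemma H_op_tendsto:
  assumes F: "\<And>n. F n \<in> M_plus" and inc: "\<And>s. incseq (\<lambda>n. F n s)"
    and lim: "\<And>s. 0 < s \<Longrightarrow> (\<lambda>n. F n s) \<longlonglongrightarrow> f s" and t: "0 < t"
  shows "(\<lambda>n. H_op I m (F n) t) \<longlonglongrightarrow> H_op I m f t"
proof -
  let ?k = "\<lambda>s. indicator {t<..} s * ennreal (1 / I s) * \<kappa> t s ^ (m - 1)"
  have [measurable]: "F n \<in> borel_measurable halfline" for n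
    using F by (simp add: M_plus_def)
  have "(\<lambda>n. \<integral>\<^sup>+s. F n s * ?k s \<partial>halfline) \<longlonglongrightarrow> (\<integral>\<^sup>+s. f s * ?k s \<partial>halfline)"
  proof (rule nn_integral_LIMSEQ)
    show mono: "incseq (\<lambda>n s. F n s * ?k s)"
      using incseqD[OF inc] by (auto simp: incseq_def le_fun_def intro!: mult_right_mono)
    show "(\<lambda>s. F n s * ?k s) \<in> borel_measurable halfline" for n
      by (intro borel_measurable_times_ennreal measurable_kernel2 t) simp
    show "(\<lambda>n. F n s * ?k s) \<longlonglongrightarrow> f s * ?k s" for s
    proof (cases "t < s")
      case True
      \<comment> \<open>The supremum of an increasing sequence commutes with the kernel factor in
        \<open>ennreal\<close> without any finiteness condition.\<close>
      then have "f s = (SUP n. F n s)"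
        using t lim[of s] LIMSEQ_SUP[OF inc[of s]] LIMSEQ_unique by auto
      then have "f s * ?k s = (SUP n. F n s * ?k s)"
        by (simp add: SUP_mult_right_ennreal)
      moreover have "incseq (\<lambda>n. F n s * ?k s)"
        using mono by (simp add: incseq_def le_fun_def)
      ultimately show ?thesis using LIMSEQ_SUP by metis
    qed simp
  qed
  then show ?thesis by (simp only: H_op_eq[OF t])
qed

text \<open>Truncating \<open>f\<close> in height and support provides staircases of every ratio.
  For a fixed truncation the ratio tends to 1, so its factor disappears; the truncation is then
  removed by monotone convergence and the Fatou property.\<close>

lemma norm_H_op_le:
  assumes X: "ri_banach_function_norm X" and Y: "ri_banach_function_norm Y" and D: "0 \<le> D"
    and bound: "\<And>g. g \<in> bfs_nonneg X \<Longrightarrow> antimono_on {0<..} g \<Longrightarrow> Y (H_op I m g) \<le> ennreal D * X g"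
    and f: "f \<in> bfs_nonneg X"
  shows "Y (H_op I m f) \<le> ennreal (2 ^ (m + 1) * D) * X f"
proof -
  interpret X: ri_banach_function_norm X by fact
  interpret Y: ri_banach_function_norm Y by fact
  have fM: "f \<in> M_plus" and fin: "X f < \<infinity>" using f by (auto simp: bfs_nonneg_def)
  then have [measurable]: "f \<in> borel_measurable halfline" by (simp add: M_plus_def)
  define F where "F n t = min (f t) (of_nat (Suc n)) * indicator {..real (Suc n)} t" for n t
  have "(\<lambda>t. indicator {..real (Suc n)} t :: ennreal) \<in> borel_measurable halfline" for n
    by (rule borel_imp_measurable_halfline) simp
  then have F_M: "F n \<in> M_plus" for n
    unfolding M_plus_def F_def by (intro borel_measurable_times_ennreal) measurable
  have F_le: "X (F n) \<le> X f" for n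
    by (intro X.P2 F_M fM AE_I2) (auto simp: F_def indicator_def)
  have trunc: "Y (H_op I m (F n)) \<le> ennreal (2 ^ (m + 1) * D) * X f" for n
  proof (rule LIMSEQ_le_const)
    have "Y (H_op I m (F n)) \<le> ennreal (2 ^ (m + 1) * D * (1 + 1 / real (Suc k))) * X f" for k
    proof -
      have "\<exists>x \<mu>. staircase (F n) x \<mu> (1 + 1 / real (Suc k))"
      proof (rule staircase_exists[OF F_M])
        show "F n t \<le> ennreal (real (Suc n))" for t
          by (auto simp: F_def indicator_def ennreal_of_nat_eq_real_of_nat simp del: of_nat_Suc)
        show "F n t = 0" if "real (Suc n) < t" for t using that by (simp add: F_def indicator_def)
      qed auto
      then obtain x \<mu> where "staircase (F n) x \<mu> (1 + 1 / real (Suc k))" by blast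
      then have "Y (H_op I m (F n)) \<le> ennreal (2 ^ (m + 1) * D * (1 + 1 / real (Suc k))) * X (F n)"
        using F_le[of n] fin by (intro norm_H_op_le_stair[OF X Y D bound]) auto
      also have "\<dots> \<le> ennreal (2 ^ (m + 1) * D * (1 + 1 / real (Suc k))) * X f"
        by (intro mult_left_mono F_le) auto
      finally show ?thesis .
    qed
    then show "\<exists>N. \<forall>k\<ge>N. Y (H_op I m (F n)) \<le> ennreal (2 ^ (m + 1) * D * (1 + 1 / real (Suc k))) * X f"
      by blast
    have "(\<lambda>k. 2 ^ (m + 1) * D * (1 + 1 / real (Suc k))) \<longlonglongrightarrow> 2 ^ (m + 1) * D * (1 + 0)"
      by (intro tendsto_intros lim_1_over_n[THEN LIMSEQ_Suc])
    then show "(\<lambda>k. ennreal (2 ^ (m + 1) * D * (1 + 1 / real (Suc k))) * X f)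
        \<longlonglongrightarrow> ennreal (2 ^ (m + 1) * D) * X f"
      using fin by (intro tendsto_mult_ennreal tendsto_ennrealI tendsto_const) auto
  qed
  show ?thesis
  proof (rule Y.norm_le_of_tendsto[of "\<lambda>n. H_op I m (F n)"])
    show "AE t in halfline. (\<lambda>n. H_op I m (F n) t) \<longlonglongrightarrow> H_op I m f t"
    proof (rule AE_I2)
      fix t assume "t \<in> space halfline"
      then have "0 < t" by simp
      show "(\<lambda>n. H_op I m (F n) t) \<longlonglongrightarrow> H_op I m f t"
      proof (rule H_op_tendsto[OF F_M _ _ \<open>0 < t\<close>])
        show "incseq (\<lambda>n. F n s)" for s
          unfolding F_def by (intro incseq_SucI mult_mono min.mono) (auto simp: indicator_def)
        fix s :: real
        have "(\<lambda>n. min (f s) (of_nat (Suc n))) \<longlonglongrightarrow> min (f s) top"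
          by (intro tendsto_min tendsto_const LIMSEQ_Suc[OF of_nat_tendsto_top_ennreal])
        moreover have "eventually (\<lambda>n. min (f s) (of_nat (Suc n)) = F n s) sequentially"
        proof -
          obtain k :: nat where "s \<le> real k" using real_arch_simple by blast
          then show ?thesis
            by (intro eventually_sequentiallyI[of k]) (auto simp: F_def indicator_def)
        qed
        ultimately show "(\<lambda>n. F n s) \<longlonglongrightarrow> f s"
          using Lim_transform_eventually by fastforce
      qed
    qed
  qed (rule antimono_M_plus antimono_H_op trunc)+
qed

end

text \<open>The inequalities of the theorem live in \<open>ereal\<close> because their real
  constants may be negative, which \<open>ennreal\<close> would truncate to 0.\<close>

lemma enn2ereal_le_mult_iff:
  "0 \<le> C \<Longrightarrow> enn2ereal a \<le> ereal C * enn2ereal b \<longleftrightarrow> a \<le> ennreal C * b"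
  by (simp add: less_eq_ennreal.rep_eq times_ennreal.rep_eq)

text \<open>The indicator of \<open>(0, 1]\<close> is non-increasing with positive finite norm, so a
  negative \<open>C\<close> would make the left-hand side negative.\<close>

lemma bound_constant_nonneg:
  assumes X: "ri_banach_function_norm X"
    and bound: "\<forall>f\<in>bfs_nonneg X. antimono_on {0<..} f \<longrightarrow> enn2ereal (T f) \<le> ereal C * enn2ereal (X f)"
  shows "0 \<le> C"
proof (rule ccontr)
  assume "\<not> 0 \<le> C"
  interpret X: ri_banach_function_norm X by fact
  define u :: "real \<Rightarrow> ennreal" where "u = indicator {0<..1}"
  have set: "{0<..1::real} \<in> sets halfline" by (intro sets_halfline_borel) auto
  then have uM: "u \<in> M_plus" by (simp add: u_def M_plus_def)
  have fin: "X u < \<infinity>"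
    unfolding u_def using set emeasure_halfline_Ioc[of 0 1] by (intro X.P4) auto
  have "X u \<noteq> 0"
  proof
    assume "X u = 0"
    then have "AE t in halfline. u t = 0" using X.P1_zero[OF uM] by simp
    then have "AE t in halfline. t \<notin> {0<..1}" by eventually_elim (simp add: u_def indicator_def split: if_splits)
    then have "emeasure halfline {0<..1} = 0" using set AE_iff_null_sets by blast
    then show False using emeasure_halfline_Ioc[of 0 1] by simp
  qed
  then obtain x where x: "X u = ennreal x" "0 < x"
    using fin by (cases "X u") (auto simp: ennreal_eq_0_iff)
  have "antimono_on {0<..} u" by (intro monotone_onI) (auto simp: u_def indicator_def)
  then have "enn2ereal (T u) \<le> ereal (C * x)"
    using bound uM fin x by (auto simp: bfs_nonneg_def)
  moreover have "C * x < 0" using \<open>\<not> 0 \<le> C\<close> x by (simp add: mult_neg_pos)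
  ultimately show False using enn2ereal_nonneg[of "T u"]
    by (metis ereal_less(2) ereal_less_eq(3) leD less_ereal.simps(1) order_trans zero_ereal_def)
qed

theorem theorem3p10:
  fixes m :: nat and I :: "real \<Rightarrow> real"
    and normX normY :: "(real \<Rightarrow> ennreal) \<Rightarrow> ennreal"
  assumes "m \<ge> 1"
    and "\<And>t. 0 < t \<Longrightarrow> 0 < I t"
    and "mono_on {0<..} I"
    and "\<And>t. 0 < t \<Longrightarrow> continuous (at_left t) I"
    and "ri_banach_function_norm normX"
    and "ri_banach_function_norm normY"
    and "essentially_decreasing I m"
  shows "((\<exists>C::real. \<forall>f\<in>bfs_nonneg normX.
             enn2ereal (normY (H_op I m f)) \<le> ereal C * enn2ereal (normX f))
          \<longleftrightarrow>
          (\<exists>C'::real. \<forall>f\<in>bfs_nonneg normX. antimono_on {0<..} f \<longrightarrow>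
             enn2ereal (normY (H_op I m f)) \<le> ereal C' * enn2ereal (normX f)))
       \<and> (\<forall>C'::real.
            (\<forall>f\<in>bfs_nonneg normX. antimono_on {0<..} f \<longrightarrow>
               enn2ereal (normY (H_op I m f)) \<le> ereal C' * enn2ereal (normX f))
            \<longrightarrow>
            (\<forall>f\<in>bfs_nonneg normX.
               enn2ereal (normY (H_op I m f)) \<le> ereal (2 ^ (m + 1) * C') * enn2ereal (normX f)))"
proof -
  interpret hardy_kernel I m using assms(1-3) by unfold_locales
  have "enn2ereal (normY (H_op I m f)) \<le> ereal (2 ^ (m + 1) * C') * enn2ereal (normX f)"
    if bound: "\<forall>f\<in>bfs_nonneg normX. antimono_on {0<..} f \<longrightarrow>
               enn2ereal (normY (H_op I m f)) \<le> ereal C' * enn2ereal (normX f)"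
      and f: "f \<in> bfs_nonneg normX" for C' f
  proof -
    have C': "0 \<le> C'" by (rule bound_constant_nonneg[OF assms(5) bound])
    then have "normY (H_op I m f) \<le> ennreal (2 ^ (m + 1) * C') * normX f"
      using bound by (intro norm_H_op_le[OF assms(5,6)] f) (auto simp: enn2ereal_le_mult_iff)
    then show ?thesis using C' by (subst enn2ereal_le_mult_iff) auto
  qed
  \<comment> \<open>The remaining implication restricts (i) to non-increasing functions with the
    same constant.\<close>
  then show ?thesis by blast
qed

end
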